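(* Let $\omega_1$ and $\omega_2$ be weights on $\mathbf R^{2d}$, let $v\in\mathscr P_E(\mathbf R^{2d})$ be submultiplicative, and let $\mathscr B$ be either an invariant BF-space on $\mathbf R^{2d}$ with respect to $v$, or a mixed quasi-normed space of Lebesgue type on $\mathbf R^{2d}$. Let $i$ be the injection $$i: M(\omega_1,\mathscr B)\to M(\omega_2,\mathscr B),\qquad i(f)=f. \qquad ( * )$$ Then the following is true: (1) if $\omega_2/\omega_1$ is bounded, then the map $( * )$ is continuous; (2) if in addition $\omega_1,\omega_2\in\mathscr P_E(\mathbf R^{2d})$ and $v$ is bounded, then the map $( * )$ is continuous if and only if $\omega_2/\omega_1\le C$ for some constant $C>0$.
   Context: Notation: $f(\theta)\lesssim g(\theta)$ means $f(\theta)\le c\,g(\theta)$ for a constant $c>0$ independent of $\theta$. "The map $( * )$ is continuous" includes that it is well defined, i.e. $M(\omega_1,\mathscr B)\subseteq M(\omega_2,\mathscr B)$. Weights. A weight on $\mathbf R^n$ is a positive function $\omega$ with $\omega,1/\omega\in L^\infty_{loc}(\mathbf R^n)$. $\mathscr P_E(\mathbf R^n)$ is the set of moderate weights: weights $\omega$ for which there is a weight $v$ with $\omega(x_1+x_2)\lesssim\omega(x_1)v(x_2)$ for all $x_1,x_2\in\mathbf R^n$ (then $v$ can be chosen as $e^{r|\cdot|}$ for some $r>0$). A weight $v$ is submultiplicative if it is even and $v(x_1+x_2)\lesssim v(x_1)v(x_2)$. Gelfand–Shilov space. $\Sigma_1(\mathbf R^n)$ is the Fréchet space of all $f\in C^\infty(\mathbf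 R^n)$ such that $\sup_{\alpha,\beta\in\mathbf N^n,\,x\in\mathbf R^n}\frac{|x^\beta\partial^\alpha f(x)|}{h^{|\alpha+\beta|}\alpha!\,\beta!}<\infty$ for every $h>0$ (these are its seminorms); $\Sigma_1'(\mathbf R^n)$ is its dual. Invariant BF-spaces. A Banach space $\mathscr B\subseteq L^1_{loc}(\mathbf R^n)$ which contains $\Sigma_1(\mathbf R^n)$ with continuous embedding is an invariant BF-space on $\mathbf R^n$ with respect to $v$ if there is a constant $C$ such that: (i) if $x\in\mathbf R^n$ and $f\in\mathscr B$, then $f(\cdot-x)\in\mathscr B$ and $\|f(\cdot-x)\|_{\mathscr B}\le Cv(x)\|f\|_{\mathscr B}$; (ii) if $f,g\in L^1_{loc}(\mathbf R^n)$, $g\in\mathscr B$ and $|f|\le|g|$, then $f\in\mathscr B$ and $\|f\|_{\mathscr B}\le C\|g\|_{\mathscr B}$. As in the paper, invariant BF-spaces are understood to satisfy Minkowski's inequality $\|f*\varphi\|_{\mathscr B}\le C\|f\|_{\mathscr B}\|\varphi v\|_{L^1}$ for $f\in\mathscr B$, $\varphi\in\Sigma_1(\mathbf R^n)$. Mixed quasi-normed spaces of Lebesgue type. These are the spaces $L^{\boldsymbol p}_E(\mathbf R^n)$, where $E=\{e_1,\dots,e_n\}$ is an ordered basis of $\mathbf R^n$ and $\boldsymbol p=(p_1,\dots,p_n)\in(0,\infty]^n$. With $r=\min(1,p_1,\dots,p_n)$, the space consists of all $f\in L^r_{loc}(\mathbf R^n)$ with $\|f\|_{L^{\boldsymbol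 p}_E}=\|g_{n-1}\|_{L^{p_n}(\mathbf R)}<\infty$, where $g_0(x_1,\dots,x_n)=|f(x_1e_1+\cdots+x_ne_n)|$ and $g_k(x_{k+1},\dots,x_n)=\|g_{k-1}(\cdot,x_{k+1},\dots,x_n)\|_{L^{p_k}(\mathbf R)}$ for $k=1,\dots,n-1$. They are translation invariant with respect to the weight $1$. Modulation spaces. Let $h_\alpha$, $\alpha\in\mathbf N^d$, be the ($L^2$-orthonormal) Hermite functions $h_\alpha(x)=\pi^{-d/4}(-1)^{|\alpha|}(2^{|\alpha|}\alpha!)^{-1/2}e^{|x|^2/2}\partial^\alpha e^{-|x|^2}$. $\mathcal H_\flat'(\mathbf R^d)$ is the set of formal expansions $f=\sum_{\alpha\in\mathbf N^d}c_\alpha(f)h_\alpha$ with $|c_\alpha(f)|\lesssim r^{|\alpha|}\alpha!^{1/2}$ for every $r>0$; it contains $\Sigma_1'(\mathbf R^d)$ via $c_\alpha(f)=(f,h_\alpha)$. The Bargmann transform of $f\in\mathcal H_\flat'(\mathbf R^d)$ is the entire function $(\mathfrak V_df)(z)=\sum_\alpha c_\alpha(f)z^\alpha/\sqrt{\alpha!}$ on $\mathbf C^d$ (for $f\in L^2$ it equals $\pi^{-d/4}\int f(y)\exp(-\frac12(\langle z,z\rangle+|y|^2)+\sqrt2\langle z,y\rangle)\,dy$, with $\langle\cdot,\cdot\rangle$ bilinear). Let $\phi(x)=\pi^{-d/4}e^{-|x|^2/2}$. The short-time Fourier transform $V_\phi f$ of $f\in\mathcal H_\flat'(\mathbf R^d)$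 is the function on $\mathbf R^{2d}$ determined by $$(\mathfrak V_df)(x+i\xi)=(2\pi)^{d/2}e^{\frac12(|x|^2+|\xi|^2)}e^{-i\langle x,\xi\rangle}(V_\phi f)(\sqrt2x,-\sqrt2\xi);$$ for $f\in L^2$ this is $V_\phi f(x,\xi)=(2\pi)^{-d/2}\int f(y)\overline{\phi(y-x)}e^{-i\langle y,\xi\rangle}\,dy$. For a weight $\omega$ on $\mathbf R^{2d}$, $M(\omega,\mathscr B)$ consists of all $f\in\mathcal H_\flat'(\mathbf R^d)$ such that $\|f\|_{M(\omega,\mathscr B)}=\|V_\phi f\cdot\omega\|_{\mathscr B}$ is finite. When $\omega\in\mathscr P_E(\mathbf R^{2d})$, the paper equivalently takes $f\in\Sigma_1'(\mathbf R^d)$ and any window in $\Sigma_1(\mathbf R^d)\setminus0$. *)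

theory Defs
  imports "HOL-Analysis.Analysis" "HOL-Probability.Essential_Supremum"
begin

text \<open>
  \<open>\<real>\<^sup>n\<close> is an arbitrary Euclidean space \<^typ>\<open>'a::euclidean_space\<close> with coordinates
  given by \<^const>\<open>Basis\<close>; the phase space \<open>\<real>\<^sup>2\<^sup>d\<close> is \<^typ>\<open>(real ^ 'd) \<times> (real ^ 'd)\<close>.
  Spaces of functions modulo null sets are represented by sets of functions on which
  the norm vanishes exactly on the functions that are zero almost everywhere.
  Measurability is always with respect to the complete measure \<^const>\<open>lebesgue\<close>.
\<close>

section \<open>Weights\<close>

definition Linf_loc :: "('a::euclidean_space \<Rightarrow> real) \<Rightarrow> bool" where
  "Linf_loc f \<longleftrightarrow> f \<in> borel_measurable lebesgue \<and>
     (\<forall>K. compact K \<longrightarrow> (\<exists>C. AE x in lebesgue. x \<in> K \<longrightarrow> \<bar>f x\<bar> \<le> C))"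

definition weight :: "('a::euclidean_space \<Rightarrow> real) \<Rightarrow> bool" where
  "weight \<omega> \<longleftrightarrow> (\<forall>x. 0 < \<omega> x) \<and> Linf_loc \<omega> \<and> Linf_loc (\<lambda>x. 1 / \<omega> x)"

definition moderate_weight :: "('a::euclidean_space \<Rightarrow> real) \<Rightarrow> bool" where
  "moderate_weight \<omega> \<longleftrightarrow> weight \<omega> \<and>
     (\<exists>v. weight v \<and> (\<exists>c>0. \<forall>x y. \<omega> (x + y) \<le> c * (\<omega> x * v y)))"

definition submultiplicative :: "('a::euclidean_space \<Rightarrow> real) \<Rightarrow> bool" where
  "submultiplicative v \<longleftrightarrow> weight v \<and> (\<forall>x. v (- x) = v x) \<and>
     (\<exists>c>0. \<forall>x y. v (x + y) \<le> c * (v x * v y))"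

section \<open>The Gelfand--Shilov space\<close>

definition partial_deriv ::
    "'a \<Rightarrow> ('a::euclidean_space \<Rightarrow> complex) \<Rightarrow> 'a \<Rightarrow> complex" where
  "partial_deriv b f x = vector_derivative (\<lambda>t. f (x + t *\<^sub>R b)) (at 0)"

primrec Ck :: "nat \<Rightarrow> ('a::euclidean_space \<Rightarrow> complex) \<Rightarrow> bool" where
  "Ck 0 f \<longleftrightarrow> continuous_on UNIV f"
| "Ck (Suc k) f \<longleftrightarrow> (\<forall>x. f differentiable (at x)) \<and> (\<forall>b\<in>Basis. Ck k (partial_deriv b f))"

definition smooth :: "('a::euclidean_space \<Rightarrow> complex) \<Rightarrow> bool" where
  "smooth f \<longleftrightarrow> (\<forall>k. Ck k f)"

text \<open>
  Multi-indices on an abstract Euclidean space are functions \<open>\<alpha> :: 'a \<Rightarrow> nat\<close> of which only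
  the values on \<^const>\<open>Basis\<close> matter.  The partial derivatives in \<open>\<partial>\<^sup>\<alpha>\<close> are applied in the order
  of a fixed enumeration of the basis; on smooth functions the order is irrelevant.
\<close>

definition basis_enum :: "'a::euclidean_space list" where
  "basis_enum = (SOME bs. distinct bs \<and> set bs = Basis)"

definition mderiv ::
    "('a \<Rightarrow> nat) \<Rightarrow> ('a::euclidean_space \<Rightarrow> complex) \<Rightarrow> 'a \<Rightarrow> complex" where
  "mderiv \<alpha> f = foldr (\<lambda>b. partial_deriv b ^^ \<alpha> b) basis_enum f"

definition GS_seminorm :: "real \<Rightarrow> ('a::euclidean_space \<Rightarrow> complex) \<Rightarrow> ennreal" where
  "GS_seminorm h f = (SUP (\<alpha>, \<beta>, x) \<in> UNIV.
     ennreal (norm ((\<Prod>b\<in>Basis. (x \<bullet> b) ^ \<beta> b) *\<^sub>R mderiv \<alpha> f x) /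
       (h ^ (\<Sum>b\<in>Basis. \<alpha> b + \<beta> b) * (\<Prod>b\<in>Basis. fact (\<alpha> b)) * (\<Prod>b\<in>Basis. fact (\<beta> b)))))"

definition GS_space :: "('a::euclidean_space \<Rightarrow> complex) set" where
  "GS_space = {f. smooth f \<and> (\<forall>h>0. GS_seminorm h f < \<infinity>)}"

section \<open>Invariant BF-spaces\<close>

definition Lr_loc :: "real \<Rightarrow> ('a::euclidean_space \<Rightarrow> complex) set" where
  "Lr_loc r = {f \<in> borel_measurable lebesgue.
     \<forall>K. compact K \<longrightarrow> (\<integral>\<^sup>+x\<in>K. ennreal (norm (f x) powr r) \<partial>lebesgue) < \<infinity>}"

definition convol ::
    "('a::euclidean_space \<Rightarrow> complex) \<Rightarrow> ('a \<Rightarrow> complex) \<Rightarrow> 'a \<Rightarrow> complex" where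
  "convol f g x = (\<integral>y. f (x - y) * g y \<partial>lebesgue)"

text \<open>A Banach space \<open>B \<subseteq> L\<^sup>1\<^sub>l\<^sub>o\<^sub>c\<close> with norm \<open>N\<close>; the values of \<open>N\<close> outside \<open>B\<close> are irrelevant.\<close>

locale banach_function_space =
  fixes B :: "('a::euclidean_space \<Rightarrow> complex) set"
    and N :: "('a \<Rightarrow> complex) \<Rightarrow> real"
  assumes subset_L1_loc: "B \<subseteq> Lr_loc 1"
    and zero_mem: "(\<lambda>x. 0) \<in> B"
    and add_mem: "f \<in> B \<Longrightarrow> g \<in> B \<Longrightarrow> (\<lambda>x. f x + g x) \<in> B"
    and scale_mem: "f \<in> B \<Longrightarrow> (\<lambda>x. c * f x) \<in> B"
    and AE_eq_mem: "f \<in> B \<Longrightarrow> (AE x in lebesgue. f x = g x) \<Longrightarrow> g \<in> B"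
    and norm_nonneg: "f \<in> B \<Longrightarrow> 0 \<le> N f"
    and norm_eq_0_iff: "f \<in> B \<Longrightarrow> N f = 0 \<longleftrightarrow> (AE x in lebesgue. f x = 0)"
    and norm_scale: "f \<in> B \<Longrightarrow> N (\<lambda>x. c * f x) = norm c * N f"
    and norm_triangle: "f \<in> B \<Longrightarrow> g \<in> B \<Longrightarrow> N (\<lambda>x. f x + g x) \<le> N f + N g"
    and norm_complete:
      "(\<And>i. F i \<in> B) \<Longrightarrow> (\<forall>\<epsilon>>0. \<exists>M. \<forall>i\<ge>M. \<forall>j\<ge>M. N (\<lambda>x. F i x - F j x) < \<epsilon>) \<Longrightarrow>
       \<exists>f\<in>B. (\<lambda>i. N (\<lambda>x. F i x - f x)) \<longlonglongrightarrow> 0"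

text \<open>
  In \<open>GS_embedding\<close>, \<^const>\<open>GS_seminorm\<close> \<open>h\<close> increases as \<open>h\<close> decreases to \<open>0\<close>, so the balls of single
  seminorms form neighbourhood bases of the topology of the Gelfand--Shilov space.
\<close>

locale invariant_BF_space = banach_function_space B N
  for B :: "('a::euclidean_space \<Rightarrow> complex) set"
    and N :: "('a \<Rightarrow> complex) \<Rightarrow> real" +
  fixes v :: "'a \<Rightarrow> real"
  assumes GS_subset: "GS_space \<subseteq> B"
    and GS_embedding:
      "f \<in> GS_space \<Longrightarrow> \<epsilon> > 0 \<Longrightarrow>
       \<exists>h>0. \<exists>\<delta>>0. \<forall>g\<in>GS_space. GS_seminorm h (\<lambda>x. g x - f x) < ennreal \<delta> \<longrightarrow>
         N (\<lambda>x. g x - f x) < \<epsilon>"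
    and invariant_solid:
      "\<exists>C. (\<forall>f\<in>B. \<forall>x. (\<lambda>y. f (y - x)) \<in> B \<and> N (\<lambda>y. f (y - x)) \<le> C * v x * N f) \<and>
           (\<forall>f\<in>Lr_loc 1. \<forall>g\<in>B. (AE x in lebesgue. norm (f x) \<le> norm (g x)) \<longrightarrow>
              f \<in> B \<and> N f \<le> C * N g)"
    and Minkowski:
      "\<exists>C. \<forall>f\<in>B. \<forall>\<phi>\<in>GS_space. convol f \<phi> \<in> B \<and>
         ennreal (N (convol f \<phi>)) \<le>
           ennreal (C * N f) * (\<integral>\<^sup>+y. ennreal (norm (\<phi> y * v y)) \<partial>lebesgue)"

section \<open>Mixed quasi-normed spaces of Lebesgue type\<close>

text \<open>The power \<open>x\<^sup>a\<close> for \<open>x \<in> [0, \<infinity>]\<close> and \<open>a > 0\<close>.\<close>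

definition ennreal_powr :: "ennreal \<Rightarrow> real \<Rightarrow> ennreal" where
  "ennreal_powr x a = (if x = \<infinity> then \<infinity> else ennreal (enn2real x powr a))"

definition Lp_norm :: "ennreal \<Rightarrow> (real \<Rightarrow> ennreal) \<Rightarrow> ennreal" where
  "Lp_norm p g =
     (if p = \<infinity> then esssup lebesgue g
      else ennreal_powr (\<integral>\<^sup>+t. ennreal_powr (g t) (enn2real p) \<partial>lebesgue) (1 / enn2real p))"

text \<open>
  The function \<open>g\<^sub>k\<close> of the variables \<open>x\<^sub>k\<^sub>+\<^sub>1, \<dots>, x\<^sub>n\<close>, regarded as a function of all coordinates
  \<open>x 0, \<dots>, x (n - 1)\<close> (counted from 0) that does not depend on \<open>x i\<close> for \<open>i < k\<close>.
  In particular \<open>g\<^sub>n\<close> is constant.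
\<close>

primrec mixed_iter ::
    "(nat \<Rightarrow> 'a::euclidean_space) \<Rightarrow> (nat \<Rightarrow> ennreal) \<Rightarrow> ('a \<Rightarrow> complex) \<Rightarrow>
     nat \<Rightarrow> (nat \<Rightarrow> real) \<Rightarrow> ennreal" where
  "mixed_iter e p f 0 = (\<lambda>x. ennreal (norm (f (\<Sum>i<DIM('a). x i *\<^sub>R e i))))"
| "mixed_iter e p f (Suc k) = (\<lambda>x. Lp_norm (p k) (\<lambda>t. mixed_iter e p f k (x(k := t))))"

definition mixed_norm ::
    "(nat \<Rightarrow> 'a::euclidean_space) \<Rightarrow> (nat \<Rightarrow> ennreal) \<Rightarrow> ('a \<Rightarrow> complex) \<Rightarrow> ennreal" where
  "mixed_norm e p f = mixed_iter e p f DIM('a) (\<lambda>_. 0)"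

definition mixed_Lebesgue ::
    "(nat \<Rightarrow> 'a::euclidean_space) \<Rightarrow> (nat \<Rightarrow> ennreal) \<Rightarrow> ('a \<Rightarrow> complex) set" where
  "mixed_Lebesgue e p =
     {f \<in> Lr_loc (enn2real (Min (insert 1 (p ` {..<DIM('a)})))). mixed_norm e p f < \<infinity>}"

definition ordered_basis :: "(nat \<Rightarrow> 'a::euclidean_space) \<Rightarrow> bool" where
  "ordered_basis e \<longleftrightarrow> inj_on e {..<DIM('a)} \<and> independent (e ` {..<DIM('a)}) \<and>
     span (e ` {..<DIM('a)}) = UNIV"

definition mixed_Lebesgue_space ::
    "('a::euclidean_space \<Rightarrow> complex) set \<Rightarrow> (('a \<Rightarrow> complex) \<Rightarrow> real) \<Rightarrow> bool" where
  "mixed_Lebesgue_space B N \<longleftrightarrow>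
     (\<exists>e p. ordered_basis e \<and> (\<forall>i<DIM('a). 0 < p i) \<and>
        B = mixed_Lebesgue e p \<and> (\<forall>f\<in>B. N f = enn2real (mixed_norm e p f)))"

section \<open>Modulation spaces\<close>

text \<open>
  A formal expansion \<open>\<Sum>\<^sub>\<alpha> c\<^sub>\<alpha> h\<^sub>\<alpha>\<close> in the Hermite functions on \<open>\<real>\<^sup>d\<close> is represented by its family of
  coefficients \<open>c\<close>, indexed by the multi-indices \<open>\<alpha> :: 'd \<Rightarrow> nat\<close>.
\<close>

type_synonym 'd hermite_expansion = "('d \<Rightarrow> nat) \<Rightarrow> complex"

definition H_flat' :: "'d::finite hermite_expansion set" where
  "H_flat' = {c. \<forall>r>0. \<exists>C. \<forall>\<alpha>.
     norm (c \<alpha>) \<le> C * (r ^ (\<Sum>i\<in>UNIV. \<alpha> i) * sqrt (\<Prod>i\<in>UNIV. fact (\<alpha> i)))}"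

definition Bargmann :: "'d::finite hermite_expansion \<Rightarrow> complex ^ 'd \<Rightarrow> complex" where
  "Bargmann c z =
     (\<Sum>\<^sub>\<infinity>\<alpha>. c \<alpha> * (\<Prod>i\<in>UNIV. (z $ i) ^ \<alpha> i) / of_real (sqrt (\<Prod>i\<in>UNIV. fact (\<alpha> i))))"

text \<open>
  The short-time Fourier transform with window \<open>\<phi>(x) = \<pi>\<^sup>-\<^sup>d\<^sup>/\<^sup>4 exp (- |x|\<^sup>2 / 2)\<close>, obtained by solving the identity
  \<open>Bargmann_eq_STFT\<close> below for \<open>V\<^sub>\<phi> f\<close>.
\<close>

definition STFT ::
    "'d::finite hermite_expansion \<Rightarrow> (real ^ 'd) \<times> (real ^ 'd) \<Rightarrow> complex" where
  "STFT c = (\<lambda>(y, \<eta>).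
     let x = (1 / sqrt 2) *\<^sub>R y; \<xi> = - (1 / sqrt 2) *\<^sub>R \<eta> in
       of_real ((2 * pi) powr (- real CARD('d) / 2) * exp (- ((norm x)\<^sup>2 + (norm \<xi>)\<^sup>2) / 2)) *
       exp (\<i> * of_real (x \<bullet> \<xi>)) * Bargmann c (\<chi> j. Complex (x $ j) (\<xi> $ j)))"

lemma Bargmann_eq_STFT:
  fixes c :: "'d::finite hermite_expansion" and x \<xi> :: "real ^ 'd"
  shows "Bargmann c (\<chi> j. Complex (x $ j) (\<xi> $ j)) =
    of_real ((2 * pi) powr (real CARD('d) / 2) * exp (((norm x)\<^sup>2 + (norm \<xi>)\<^sup>2) / 2)) *
    exp (- \<i> * of_real (x \<bullet> \<xi>)) * STFT c (sqrt 2 *\<^sub>R x, - sqrt 2 *\<^sub>R \<xi>)"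
proof -
  define a where "a = (2 * pi) powr (real CARD('d) / 2)"
  define s where "s = ((norm x)\<^sup>2 + (norm \<xi>)\<^sup>2) / 2"
  have a: "a \<noteq> 0" "(2 * pi) powr (- (real CARD('d) / 2)) = inverse a"
    unfolding a_def by (simp_all add: powr_minus)
  have s: "(- (norm x)\<^sup>2 - (norm \<xi>)\<^sup>2) / 2 = - s"
    by (simp add: s_def field_simps)
  have "STFT c (sqrt 2 *\<^sub>R x, - sqrt 2 *\<^sub>R \<xi>) =
      of_real (inverse a * exp (- s)) * exp (\<i> * of_real (x \<bullet> \<xi>)) *
      Bargmann c (\<chi> j. Complex (x $ j) (\<xi> $ j))"
    unfolding STFT_def prod.case Let_def by (simp add: a(2) s power_mult_distrib)
  moreover have "exp (- \<i> * of_real (x \<bullet> \<xi>)) * exp (\<i> * of_real (x \<bullet> \<xi>)) = (1::complex)"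
    by (simp flip: exp_add)
  moreover have "(of_real (a * exp s) :: complex) * of_real (inverse a * exp (- s)) = 1"
    using a(1) by (simp add: exp_minus field_simps)
  ultimately show ?thesis
    unfolding a_def[symmetric] s_def[symmetric] by (simp add: mult_ac)
qed

definition modulation_space ::
    "((real ^ 'd) \<times> (real ^ 'd) \<Rightarrow> real) \<Rightarrow> ((real ^ 'd) \<times> (real ^ 'd) \<Rightarrow> complex) set \<Rightarrow>
     'd::finite hermite_expansion set" where
  "modulation_space \<omega> B = {f \<in> H_flat'. (\<lambda>X. STFT f X * of_real (\<omega> X)) \<in> B}"

definition modulation_norm ::
    "((real ^ 'd) \<times> (real ^ 'd) \<Rightarrow> real) \<Rightarrow> (((real ^ 'd) \<times> (real ^ 'd) \<Rightarrow> complex) \<Rightarrow> real) \<Rightarrow>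
     'd::finite hermite_expansion \<Rightarrow> real" where
  "modulation_norm \<omega> N f = N (\<lambda>X. STFT f X * of_real (\<omega> X))"

text \<open>
  Continuity of the map \<open>T\<close> from the space \<open>X\<close> with quasi-norm \<open>NX\<close> to the space \<open>Y\<close> with quasi-norm
  \<open>NY\<close>, including that \<open>T\<close> maps \<open>X\<close> into \<open>Y\<close>.
\<close>

definition quasinorm_continuous ::
    "'a::minus set \<Rightarrow> ('a \<Rightarrow> real) \<Rightarrow> 'b::minus set \<Rightarrow> ('b \<Rightarrow> real) \<Rightarrow> ('a \<Rightarrow> 'b) \<Rightarrow> bool" where
  "quasinorm_continuous X NX Y NY T \<longleftrightarrow> T ` X \<subseteq> Y \<and>
     (\<forall>f\<in>X. \<forall>\<epsilon>>0. \<exists>\<delta>>0. \<forall>g\<in>X. NX (g - f) < \<delta> \<longrightarrow> NY (T g - T f) < \<epsilon>)"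

definition modulation_embedding_continuous ::
    "((real ^ 'd::finite) \<times> (real ^ 'd) \<Rightarrow> real) \<Rightarrow> ((real ^ 'd) \<times> (real ^ 'd) \<Rightarrow> real) \<Rightarrow>
     ((real ^ 'd) \<times> (real ^ 'd) \<Rightarrow> complex) set \<Rightarrow>
     (((real ^ 'd) \<times> (real ^ 'd) \<Rightarrow> complex) \<Rightarrow> real) \<Rightarrow> bool" where
  "modulation_embedding_continuous \<omega>1 \<omega>2 B N \<longleftrightarrow>
     quasinorm_continuous (modulation_space \<omega>1 B) (modulation_norm \<omega>1 N)
       (modulation_space \<omega>2 B) (modulation_norm \<omega>2 N) (\<lambda>f. f)"

end

theory Submission
  imports Defs "HOL-Probability.Distributions" "HOL-Complex_Analysis.Cauchy_Integral_Formula"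
begin

text \<open>
  Both kinds of spaces \<open>B\<close> are solid: a measurable function dominated by \<open>c\<close> times an
  element of \<open>B\<close> lies in \<open>B\<close>, with norm at most \<open>c\<close> times that of the
  element, up to a fixed factor.  If \<open>\<omega>2 \<le> C \<omega>1\<close>, then solidity applied to
  \<open>V\<^sub>\<phi>f \<sqdot> \<omega>2\<close> and \<open>V\<^sub>\<phi>f \<sqdot> \<omega>1\<close> bounds
  the second modulation norm by the first; continuity follows since \<open>f \<mapsto> V\<^sub>\<phi>f\<close>
  is linear (\<open>STFT_diff\<close>) and \<open>B\<close> is closed under differences.

  For the converse, the embedding is tested on coherent states, the time-frequency shifts of the window.  The
  Bargmann transform turns them into exponentials, so that the short-time Fourier transform of the state at
  \<open>X\<close> has modulus \<open>t exp (- |Y - X|\<^sup>2 / 4)\<close> at \<open>Y\<close>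
  (\<open>norm_STFT_coherent\<close>).  A moderate weight satisfies \<open>\<omega> Y \<le> C exp (r |Y - X|)
  \<omega> X\<close> (\<open>moderate_weight_exp\<close>), and a Gaussian absorbs such a factor at the price of
  a different width.  Hence the norm of the state at \<open>X\<close> in \<open>M(\<omega>, B)\<close> is
  comparable with \<open>\<omega> X\<close>, uniformly in \<open>X\<close>, as soon as the norms in
  \<open>B\<close> of all translates of a Gaussian lie between two positive constants
  (\<open>gaussians_uniform\<close>).  A bound of the second modulation norm by the first on coherent states
  then is a bound of \<open>\<omega>2 X\<close> by \<open>\<omega>1 X\<close>.

  It remains to see that the two kinds of spaces have these properties.  In an invariant BF-space solidity is an
  axiom; Gaussians belong to it because they are in the Gelfand--Shilov space
  (\<open>gaussian_in_GS_space\<close>), and their translates have comparable norms because \<open>v\<close> is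
  bounded.  In a mixed space, one inequality for \<open>f\<close> dominated by the maximum of \<open>g\<close>
  and \<open>h\<close> (\<open>mixed_norm_max_le\<close>) gives solidity and, with the factor \<open>2\<close>,
  closedness under differences, for all exponents at once.  The Gaussians are compared with tensor products of
  one-dimensional Gaussians in the coordinates of the given basis, whose mixed norm is a product
  (\<open>mixed_norm_gaussian\<close>).
\<close>

section \<open>Gaussians in the Gelfand--Shilov space\<close>

text \<open>
  The entire extension of the one-dimensional Gaussian, to which Cauchy's estimates apply.
\<close>

definition gauss :: "real \<Rightarrow> complex \<Rightarrow> complex" where
  "gauss a z = exp (- (of_real a * z\<^sup>2))"

text \<open>
  The partial derivative of order \<open>\<kappa>\<close> of the Gaussian on the Euclidean space: up to sign, a
  product of rescaled Hermite polynomials times the Gaussian.  The family is closed under partial derivatives,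
  so that all statements about iterated derivatives reduce to one dimension.
\<close>

definition hermite_tensor :: "real \<Rightarrow> ('a \<Rightarrow> nat) \<Rightarrow> 'a::euclidean_space \<Rightarrow> complex" where
  "hermite_tensor a \<kappa> x = (\<Prod>b\<in>Basis. (deriv ^^ \<kappa> b) (gauss a) (of_real (x \<bullet> b)))"

lemma gauss_holomorphic: "gauss a holomorphic_on S"
  unfolding gauss_def by (intro holomorphic_intros)

lemma gauss_higher_deriv:
  "((deriv ^^ n) (gauss a) has_field_derivative (deriv ^^ Suc n) (gauss a) z) (at z)"
proof -
  have "(deriv ^^ n) (gauss a) holomorphic_on UNIV"
    by (rule holomorphic_higher_deriv) (auto simp: gauss_holomorphic)
  then show ?thesis
    using holomorphic_derivI[of "(deriv ^^ n) (gauss a)" UNIV z] by simp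
qed

lemma partial_deriv_hermite_tensor:
  assumes b: "b \<in> Basis"
  shows "partial_deriv b (hermite_tensor a \<kappa>) = hermite_tensor a (\<kappa>(b := Suc (\<kappa> b)))"
proof
  fix x :: 'a
  define C where "C = (\<Prod>j\<in>Basis - {b}. (deriv ^^ \<kappa> j) (gauss a) (of_real (x \<bullet> j)))"
  have split: "hermite_tensor a \<mu> (x + t *\<^sub>R b) = (deriv ^^ \<mu> b) (gauss a) (of_real (x \<bullet> b) + of_real t) * C"
    if "\<And>j. j \<noteq> b \<Longrightarrow> \<mu> j = \<kappa> j" for \<mu> t
  proof -
    have coord: "(x + t *\<^sub>R b) \<bullet> j = x \<bullet> j" if "j \<in> Basis - {b}" for j
      using that b by (auto simp: inner_add_left inner_Basis)
    have "hermite_tensor a \<mu> (x + t *\<^sub>R b) = (deriv ^^ \<mu> b) (gauss a) (of_real ((x + t *\<^sub>R b) \<bullet> b)) *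
        (\<Prod>j\<in>Basis - {b}. (deriv ^^ \<mu> j) (gauss a) (of_real ((x + t *\<^sub>R b) \<bullet> j)))"
      unfolding hermite_tensor_def by (rule prod.remove[OF finite_Basis b])
    also have "(\<Prod>j\<in>Basis - {b}. (deriv ^^ \<mu> j) (gauss a) (of_real ((x + t *\<^sub>R b) \<bullet> j))) = C"
      unfolding C_def by (intro prod.cong refl) (simp only: coord, use that in auto)
    finally show ?thesis
      using b by (simp add: inner_add_left inner_Basis)
  qed
  have "((\<lambda>z. (deriv ^^ \<kappa> b) (gauss a) (of_real (x \<bullet> b) + z) * C) has_field_derivative
      (deriv ^^ Suc (\<kappa> b)) (gauss a) (of_real (x \<bullet> b)) * C) (at (of_real 0))"
    using gauss_higher_deriv[of "\<kappa> b" a "of_real 0 + of_real (x \<bullet> b)"]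
    unfolding DERIV_shift by (intro DERIV_cmult_right) (simp add: add.commute)
  then have "((\<lambda>t. (deriv ^^ \<kappa> b) (gauss a) (of_real (x \<bullet> b) + of_real t) * C) has_vector_derivative
      (deriv ^^ Suc (\<kappa> b)) (gauss a) (of_real (x \<bullet> b)) * C) (at 0)"
    by (rule has_vector_derivative_real_field)
  then have "partial_deriv b (hermite_tensor a \<kappa>) x = (deriv ^^ Suc (\<kappa> b)) (gauss a) (of_real (x \<bullet> b)) * C"
    unfolding partial_deriv_def by (simp add: split vector_derivative_at)
  also have "\<dots> = hermite_tensor a (\<kappa>(b := Suc (\<kappa> b))) x"
    using split[of "\<kappa>(b := Suc (\<kappa> b))" 0] by simp
  finally show "partial_deriv b (hermite_tensor a \<kappa>) x = hermite_tensor a (\<kappa>(b := Suc (\<kappa> b))) x" .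
qed

lemma hermite_tensor_differentiable: "hermite_tensor a \<kappa> differentiable (at x)"
proof -
  have "((\<lambda>x. (deriv ^^ \<kappa> b) (gauss a) (of_real (x \<bullet> b))) has_derivative
      (\<lambda>h. (deriv ^^ Suc (\<kappa> b)) (gauss a) (of_real (x \<bullet> b)) * of_real (h \<bullet> b))) (at x)" for b
  proof -
    have 1: "((\<lambda>x. of_real (x \<bullet> b) :: complex) has_derivative (\<lambda>h. of_real (h \<bullet> b))) (at x)"
      by (auto intro!: derivative_eq_intros)
    have 2: "((deriv ^^ \<kappa> b) (gauss a) has_derivative (*) ((deriv ^^ Suc (\<kappa> b)) (gauss a) (of_real (x \<bullet> b))))
        (at (of_real (x \<bullet> b)))"
      using gauss_higher_deriv[of "\<kappa> b" a] unfolding has_field_derivative_def .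
    show ?thesis
      using has_derivative_compose[OF 1 2] .
  qed
  then show ?thesis
    unfolding hermite_tensor_def[abs_def] by (rule differentiableI[OF has_derivative_prod])
qed

lemma hermite_tensor_smooth: "smooth (hermite_tensor a \<kappa>)"
proof -
  have "Ck k (hermite_tensor a \<kappa>)" for k
  proof (induction k arbitrary: \<kappa>)
    case 0
    show ?case
      using hermite_tensor_differentiable[of a \<kappa>]
      by (auto simp: continuous_on_eq_continuous_at intro: differentiable_imp_continuous_within)
  next
    case (Suc k)
    then show ?case
      by (auto simp: hermite_tensor_differentiable partial_deriv_hermite_tensor)
  qed
  then show ?thesis
    by (simp add: smooth_def)
qed

lemma mderiv_hermite_tensor:
  "mderiv \<alpha> (hermite_tensor a (\<lambda>_. 0)) x = hermite_tensor a \<alpha> x"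
proof -
  have iter: "(partial_deriv b ^^ m) (hermite_tensor a \<kappa>) = hermite_tensor a (\<kappa>(b := \<kappa> b + m))"
    if "b \<in> Basis" for b :: 'a and m \<kappa>
  proof (induction m)
    case (Suc m)
    have "(partial_deriv b ^^ Suc m) (hermite_tensor a \<kappa>) = partial_deriv b (hermite_tensor a (\<kappa>(b := \<kappa> b + m)))"
      by (simp only: funpow.simps o_apply Suc.IH)
    also have "\<dots> = hermite_tensor a ((\<kappa>(b := \<kappa> b + m))(b := Suc ((\<kappa>(b := \<kappa> b + m)) b)))"
      by (rule partial_deriv_hermite_tensor[OF that])
    also have "(\<kappa>(b := \<kappa> b + m))(b := Suc ((\<kappa>(b := \<kappa> b + m)) b)) = \<kappa>(b := \<kappa> b + Suc m)"
      by (rule ext) simp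
    finally show ?case .
  qed simp
  have fold: "foldr (\<lambda>b. partial_deriv b ^^ \<alpha> b) bs (hermite_tensor a (\<lambda>_. 0)) =
      hermite_tensor a (\<lambda>b. if b \<in> set bs then \<alpha> b else 0)"
    if "set bs \<subseteq> Basis" "distinct bs" for bs
    using that
  proof (induction bs)
    case (Cons b bs)
    then show ?case
      by (auto simp: iter intro!: arg_cong[where f = "hermite_tensor a"])
  qed simp
  have "\<exists>bs::'a list. distinct bs \<and> set bs = Basis"
    using finite_distinct_list[OF finite_Basis] by blast
  then have "distinct (basis_enum :: 'a list) \<and> set (basis_enum :: 'a list) = Basis"
    unfolding basis_enum_def by (rule someI_ex)
  then show ?thesis
    unfolding mderiv_def by (subst fold) (auto simp: hermite_tensor_def intro!: prod.cong)
qed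

lemma power_le_fact_exp:
  assumes "0 \<le> (x::real)"
  shows "x ^ m \<le> fact m * exp x"
proof -
  have "(\<Sum>n\<in>{m}. inverse (fact n) * x ^ n) \<le> exp x"
    unfolding exp_def by (rule order_trans[OF sum_le_suminf]) (use assms summable_exp in auto)
  then show ?thesis
    by (simp add: field_simps)
qed

text \<open>
  Cauchy's estimate on a circle of radius \<open>R = 1 / h\<close> around \<open>t\<close> produces \<open>h ^ n
  * fact n\<close> and leaves a factor \<open>exp (- a t\<^sup>2 / 2)\<close>, because \<open>|exp (- a
  z\<^sup>2)| = exp (- a ((Re z)\<^sup>2 - (Im z)\<^sup>2))\<close>.  This factor beats \<open>\<bar>t\<bar> ^ m
  \<le> h ^ m * fact m * exp (R \<bar>t\<bar>)\<close>.
\<close>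

lemma gauss_derivative_bound:
  assumes a: "0 < a" and h: "0 < h"
  obtains C where "0 \<le> C"
    "\<And>m n t. \<bar>t\<bar> ^ m * norm ((deriv ^^ n) (gauss a) (of_real t)) \<le> C * (h ^ (m + n) * fact m * fact n)"
proof
  define R where "R = 1 / h"
  have R: "0 < R" using h by (simp add: R_def)
  define C where "C = exp (2 * a * R\<^sup>2) * exp (R\<^sup>2 / (2 * a))"
  show "0 \<le> C" by (simp add: C_def)
  fix m n :: nat and t :: real
  have circle: "norm (gauss a z) \<le> exp (2 * a * R\<^sup>2) * exp (- (a * t\<^sup>2 / 2))" if z: "norm (of_real t - z) = R" for z
  proof -
    have "(t - Re z)\<^sup>2 + (Im z)\<^sup>2 = R\<^sup>2"
      using z cmod_power2[of "of_real t - z"] by simp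
    moreover have "t\<^sup>2 \<le> 2 * (Re z)\<^sup>2 + 2 * (t - Re z)\<^sup>2"
      using zero_le_power2[of "t - 2 * Re z"] by (simp add: power2_eq_square algebra_simps)
    ultimately have "t\<^sup>2 / 2 - 2 * R\<^sup>2 \<le> (Re z)\<^sup>2 - (Im z)\<^sup>2"
      using zero_le_power2[of "t - Re z"] zero_le_power2[of "Im z"] by argo
    then have "a * (t\<^sup>2 / 2 - 2 * R\<^sup>2) \<le> a * ((Re z)\<^sup>2 - (Im z)\<^sup>2)"
      using a by simp
    then show ?thesis
      unfolding gauss_def norm_exp_eq_Re by (simp add: power2_eq_square algebra_simps flip: exp_add)
  qed
  have "norm ((deriv ^^ n) (gauss a) (of_real t)) \<le> fact n * (exp (2 * a * R\<^sup>2) * exp (- (a * t\<^sup>2 / 2))) / R ^ n"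
    by (rule Cauchy_inequality[OF gauss_holomorphic _ R circle])
      (auto intro: holomorphic_on_imp_continuous_on gauss_holomorphic)
  then have 1: "norm ((deriv ^^ n) (gauss a) (of_real t)) \<le> fact n * (exp (2 * a * R\<^sup>2) * exp (- (a * t\<^sup>2 / 2))) * h ^ n"
    by (simp add: R_def power_divide)
  have "(\<bar>t\<bar> * R) ^ m \<le> fact m * exp (\<bar>t\<bar> * R)"
    using R by (intro power_le_fact_exp) auto
  then have 2: "\<bar>t\<bar> ^ m \<le> fact m * exp (\<bar>t\<bar> * R) * h ^ m"
    using h by (simp add: R_def power_divide field_simps)
  \<comment> \<open>By the arithmetic-geometric mean inequality, \<open>exp (R |t|)\<close> is absorbed by \<open>exp (- a t\<^sup>2 / 2)\<close>.\<close>
  have "2 * a * (\<bar>t\<bar> * R) \<le> (a * \<bar>t\<bar>)\<^sup>2 + R\<^sup>2"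
    using zero_le_power2[of "a * \<bar>t\<bar> - R"] by (simp add: power2_diff)
  then have "\<bar>t\<bar> * R - a * t\<^sup>2 / 2 \<le> R\<^sup>2 / (2 * a)"
    using a by (simp add: field_simps power2_eq_square)
  then have 3: "exp (\<bar>t\<bar> * R) * exp (- (a * t\<^sup>2 / 2)) \<le> exp (R\<^sup>2 / (2 * a))"
    by (simp flip: exp_add)
  have "\<bar>t\<bar> ^ m * norm ((deriv ^^ n) (gauss a) (of_real t)) \<le>
      (fact m * exp (\<bar>t\<bar> * R) * h ^ m) * (fact n * (exp (2 * a * R\<^sup>2) * exp (- (a * t\<^sup>2 / 2))) * h ^ n)"
    by (rule mult_mono[OF 2 1]) (use h in auto)
  also have "\<dots> = (exp (\<bar>t\<bar> * R) * exp (- (a * t\<^sup>2 / 2))) * (exp (2 * a * R\<^sup>2) * (h ^ (m + n) * fact m * fact n))"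
    by (simp add: power_add mult_ac)
  also have "\<dots> \<le> exp (R\<^sup>2 / (2 * a)) * (exp (2 * a * R\<^sup>2) * (h ^ (m + n) * fact m * fact n))"
    by (rule mult_right_mono[OF 3]) (use h in auto)
  finally show "\<bar>t\<bar> ^ m * norm ((deriv ^^ n) (gauss a) (of_real t)) \<le> C * (h ^ (m + n) * fact m * fact n)"
    by (simp add: C_def mult_ac)
qed

lemma hermite_tensor_0:
  fixes x :: "'a::euclidean_space"
  shows "hermite_tensor a (\<lambda>_. 0) x = of_real (exp (- (a * (norm x)\<^sup>2)))"
proof -
  have "(norm x)\<^sup>2 = (\<Sum>b\<in>Basis. (x \<bullet> b)\<^sup>2)"
    unfolding power2_norm_eq_inner using euclidean_inner[of x x] by (simp add: power2_eq_square)
  then have "(\<Sum>b\<in>Basis. - (of_real a * (of_real (x \<bullet> b))\<^sup>2)) = (of_real (- (a * (norm x)\<^sup>2)) :: complex)"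
    by (simp add: sum_negf sum_distrib_left)
  then show ?thesis
    by (simp add: hermite_tensor_def gauss_def flip: exp_sum exp_of_real)
qed

lemma gaussian_in_GS_space:
  assumes a: "0 < a"
  shows "(\<lambda>x::'a::euclidean_space. of_real (exp (- (a * (norm x)\<^sup>2)))) \<in> GS_space"
proof -
  have "GS_seminorm h (hermite_tensor a (\<lambda>_. 0) :: 'a \<Rightarrow> complex) < \<infinity>" if h: "0 < h" for h
  proof -
    obtain C where C: "0 \<le> C" and bound:
      "\<And>m n t. \<bar>t\<bar> ^ m * norm ((deriv ^^ n) (gauss a) (of_real t)) \<le> C * (h ^ (m + n) * fact m * fact n)"
      using gauss_derivative_bound[OF a h] by blast
    have "GS_seminorm h (hermite_tensor a (\<lambda>_. 0) :: 'a \<Rightarrow> complex) \<le> ennreal (C ^ DIM('a))"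
      unfolding GS_seminorm_def
    proof (intro SUP_least, clarify, rule ennreal_leI)
      fix \<alpha> \<beta> :: "'a \<Rightarrow> nat" and x :: 'a
      have "norm ((\<Prod>b\<in>Basis. (x \<bullet> b) ^ \<beta> b) *\<^sub>R mderiv \<alpha> (hermite_tensor a (\<lambda>_. 0)) x) =
          (\<Prod>b\<in>Basis. \<bar>x \<bullet> b\<bar> ^ \<beta> b * norm ((deriv ^^ \<alpha> b) (gauss a) (of_real (x \<bullet> b))))"
        by (simp add: mderiv_hermite_tensor hermite_tensor_def abs_prod power_abs prod.distrib
            flip: prod_norm)
      also have "\<dots> \<le> (\<Prod>b\<in>(Basis::'a set). C * (h ^ (\<beta> b + \<alpha> b) * fact (\<beta> b) * fact (\<alpha> b)))"
        by (intro prod_mono) (use bound in auto)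
      also have "\<dots> = C ^ DIM('a) * (h ^ (\<Sum>b\<in>(Basis::'a set). \<alpha> b + \<beta> b) * (\<Prod>b\<in>Basis. fact (\<alpha> b)) * (\<Prod>b\<in>Basis. fact (\<beta> b)))"
        by (simp add: prod.distrib power_sum power_add mult_ac)
      finally show "norm ((\<Prod>b\<in>Basis. (x \<bullet> b) ^ \<beta> b) *\<^sub>R mderiv \<alpha> (hermite_tensor a (\<lambda>_. 0)) x) /
          (h ^ (\<Sum>b\<in>Basis. \<alpha> b + \<beta> b) * (\<Prod>b\<in>Basis. fact (\<alpha> b)) * (\<Prod>b\<in>Basis. fact (\<beta> b))) \<le> C ^ DIM('a)"
        using h by (simp add: divide_le_eq prod_pos)
    qed
    then show ?thesis
      using le_less_trans by fastforce
  qed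
  then have "hermite_tensor a (\<lambda>_. 0) \<in> (GS_space :: ('a \<Rightarrow> complex) set)"
    using hermite_tensor_smooth by (auto simp: GS_space_def)
  then show ?thesis
    by (simp add: hermite_tensor_0[abs_def])
qed

section \<open>The one-dimensional Lebesgue quasi-norms\<close>

lemma ennreal_powr_ennreal: "0 \<le> x \<Longrightarrow> ennreal_powr (ennreal x) a = ennreal (x powr a)"
  by (simp add: ennreal_powr_def)

lemma borel_measurable_ennreal_powr [measurable]: "(\<lambda>x. ennreal_powr x a) \<in> borel_measurable borel"
  unfolding ennreal_powr_def by measurable

lemma ennreal_powr_mono:
  assumes "x \<le> y" "0 < a"
  shows "ennreal_powr x a \<le> ennreal_powr y a"
proof (cases "y = \<infinity>")
  case False
  with assms have "x \<noteq> \<infinity>"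
    by (auto simp: top_unique)
  moreover have "enn2real x \<le> enn2real y"
    using assms False by (intro enn2real_mono) (auto simp: top.not_eq_extremum)
  ultimately show ?thesis
    using False assms by (simp add: ennreal_powr_def powr_mono2 ennreal_leI)
qed (simp add: ennreal_powr_def)

lemma ennreal_powr_mult:
  assumes "0 < a"
  shows "ennreal_powr (x * y) a = ennreal_powr x a * ennreal_powr y a"
proof (cases "x = \<infinity> \<or> y = \<infinity>")
  case True
  have pos: "0 < ennreal (enn2real z powr a)" if "z \<noteq> 0" "z \<noteq> \<infinity>" for z :: ennreal
    using that by (simp add: enn2real_eq_0_iff)
  show ?thesis
  proof (cases "x = 0 \<or> y = 0")
    case True
    then show ?thesis
      using assms by (auto simp: ennreal_powr_def)
  next
    case False
    with True pos show ?thesis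
      by (auto simp: ennreal_powr_def ennreal_mult_eq_top_iff ennreal_top_mult ennreal_mult_top)
  qed
next
  case False
  then show ?thesis
    by (simp add: ennreal_powr_def ennreal_mult_eq_top_iff enn2real_mult powr_mult ennreal_mult)
qed

lemma ennreal_powr_inverse:
  assumes "0 < a"
  shows "ennreal_powr (ennreal_powr x a) (1 / a) = x"
  using assms by (cases x) (auto simp: ennreal_powr_def powr_powr ennreal_enn2real_if)

lemma ennreal_powr_max:
  assumes "0 < a"
  shows "ennreal_powr (max x y) a = max (ennreal_powr x a) (ennreal_powr y a)"
  using ennreal_powr_mono[of x y a] ennreal_powr_mono[of y x a] assms
  by (auto simp: max_def)

lemma Lp_norm_top: "Lp_norm \<infinity> g = esssup lebesgue g"
  by (simp add: Lp_norm_def)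

lemma Lp_norm_finite:
  "p \<noteq> \<infinity> \<Longrightarrow> Lp_norm p g =
    ennreal_powr (\<integral>\<^sup>+t. ennreal_powr (g t) (enn2real p) \<partial>lborel) (1 / enn2real p)"
  by (simp add: Lp_norm_def nn_integral_completion)

text \<open>
  The essential supremum of a non-measurable function is \<open>\<infinity>\<close>; for measurable functions
  this characterization lets almost everywhere estimates pass through it.
\<close>

lemma esssup_lebesgue_le_iff:
  assumes "g \<in> borel_measurable lebesgue"
  shows "esssup lebesgue g \<le> (c::ennreal) \<longleftrightarrow> (AE t in lborel. g t \<le> c)"
proof
  assume "esssup lebesgue g \<le> c"
  moreover have "AE t in lborel. g t \<le> esssup lebesgue g"
    using esssup_AE[of g lebesgue] by (simp add: AE_completion_iff)
  ultimately show "AE t in lborel. g t \<le> c"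
    by (auto elim: order_trans)
next
  assume "AE t in lborel. g t \<le> c"
  then show "esssup lebesgue g \<le> c"
    using assms by (intro esssup_I) (auto simp: AE_completion_iff)
qed

text \<open>
  For a finite exponent this is Tonelli's theorem.  For \<open>p = \<infinity>\<close>, the essential supremum
  is at most \<open>c\<close> exactly where the integral of the indicator of \<open>h x t > c\<close> over
  \<open>t\<close> vanishes, and that integral depends measurably on \<open>x\<close>.
\<close>

lemma borel_measurable_Lp_norm:
  fixes h :: "'b \<Rightarrow> real \<Rightarrow> ennreal"
  assumes [measurable]: "case_prod h \<in> borel_measurable (M \<Otimes>\<^sub>M borel)"
  shows "(\<lambda>x. Lp_norm p (h x)) \<in> borel_measurable M"
proof (cases "p = \<infinity>")
  case True
  have h_section: "h x \<in> borel_measurable borel" if "x \<in> space M" for x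
    using that by measurable
  have "{x \<in> space M. esssup lebesgue (h x) \<le> c} \<in> sets M" for c
  proof -
    have "(\<lambda>x. \<integral>\<^sup>+t. indicator {t. \<not> h x t \<le> c} t \<partial>lborel) \<in> borel_measurable M"
      by (intro lborel.borel_measurable_nn_integral) (simp add: indicator_def, measurable)
    then have "{x \<in> space M. (\<integral>\<^sup>+t. indicator {t. \<not> h x t \<le> c} t \<partial>lborel) = 0} \<in> sets M"
      by measurable
    also have "{x \<in> space M. (\<integral>\<^sup>+t. indicator {t. \<not> h x t \<le> c} t \<partial>lborel) = 0} =
        {x \<in> space M. esssup lebesgue (h x) \<le> c}"
    proof (intro Collect_cong conj_cong refl)
      fix x assume x: "x \<in> space M"
      note [measurable] = h_section[OF x]
      have "(\<integral>\<^sup>+t. indicator {t. \<not> h x t \<le> c} t \<partial>lborel) = 0 \<longleftrightarrow>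
          (AE t in lborel. (indicator {t. \<not> h x t \<le> c} t :: ennreal) = 0)"
        by (rule nn_integral_0_iff_AE) measurable
      also have "\<dots> \<longleftrightarrow> (AE t in lborel. h x t \<le> c)"
        by (simp add: indicator_def)
      also have "\<dots> \<longleftrightarrow> esssup lebesgue (h x) \<le> c"
        by (rule esssup_lebesgue_le_iff[symmetric]) (simp add: measurable_completion)
      finally show "(\<integral>\<^sup>+t. indicator {t. \<not> h x t \<le> c} t \<partial>lborel) = 0 \<longleftrightarrow> esssup lebesgue (h x) \<le> c" .
    qed
    finally show ?thesis .
  qed
  then show ?thesis
    unfolding True Lp_norm_top by (rule borel_measurableI_le)
next
  case False
  then show ?thesis
    unfolding Lp_norm_finite[OF False] by measurable
qed

text \<open>
  The function \<open>f\<close> inherits Lebesgue measurability from \<open>g\<close> because the Lebesgue measure is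
  complete; for \<open>p = \<infinity>\<close> it would otherwise have norm \<open>\<infinity>\<close>.  This is how sections of Lebesgue measurable functions enter.
\<close>

lemma Lp_norm_cong_AE:
  assumes g: "g \<in> borel_measurable borel" and eq: "AE t in lborel. f t = g t"
  shows "Lp_norm p f = Lp_norm p g"
proof (cases "p = \<infinity>")
  case True
  have gL: "g \<in> borel_measurable lebesgue"
    using g by (simp add: measurable_completion)
  have "f \<in> borel_measurable lebesgue"
  proof (rule measurableI)
    fix A :: "ennreal set" assume "A \<in> sets borel"
    then have 1: "g -` A \<in> sets lebesgue"
      using measurable_sets[OF gL] by simp
    have 2: "AE t in lebesgue. t \<in> g -` A \<longleftrightarrow> t \<in> f -` A"
      unfolding AE_completion_iff using eq by (auto elim!: eventually_mono)
    have "f -` A \<in> sets lebesgue"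
      by (rule completion.in_sets_AE[OF 2 1]) simp
    then show "f -` A \<inter> space lebesgue \<in> sets lebesgue"
      by simp
  qed simp
  with gL eq show ?thesis
    unfolding True Lp_norm_top by (intro esssup_AE_cong) (auto simp: AE_completion_iff)
next
  case False
  then show ?thesis
    unfolding Lp_norm_finite[OF False] using eq
    by (intro arg_cong[where f = "\<lambda>x. ennreal_powr x _"] nn_integral_cong_AE) auto
qed

text \<open>
  A substitute for the triangle inequality valid for all exponents in \<open>(0, \<infinity>]\<close>: the
  \<open>p\<close>-th power of a maximum is at most the sum of the \<open>p\<close>-th powers, which is at most
  twice their maximum.  The constant is \<open>2 powr (1 / p)\<close> for finite \<open>p\<close>, and
  \<open>1\<close> for \<open>p = \<infinity>\<close>.
\<close>

lemma Lp_norm_max_le: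
  assumes p: "0 < p"
  obtains K :: real where "0 \<le> K"
    "\<And>f g h c. \<lbrakk>f \<in> borel_measurable borel; g \<in> borel_measurable borel; h \<in> borel_measurable borel;
      0 \<le> c; AE t in lborel. f t \<le> ennreal c * max (g t) (h t)\<rbrakk> \<Longrightarrow>
      Lp_norm p f \<le> ennreal (c * K) * max (Lp_norm p g) (Lp_norm p h)"
proof (cases "p = \<infinity>")
  case True
  have "Lp_norm p f \<le> ennreal (c * 1) * max (Lp_norm p g) (Lp_norm p h)"
    if f: "f \<in> borel_measurable borel" and "AE t in lborel. f t \<le> ennreal c * max (g t) (h t)" for f g h c
  proof -
    have "AE t in lborel. g t \<le> esssup lebesgue g" "AE t in lborel. h t \<le> esssup lebesgue h"
      using esssup_AE[of g lebesgue] esssup_AE[of h lebesgue] unfolding AE_completion_iff .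
    with that(2) have "AE t in lborel. f t \<le> ennreal c * max (esssup lebesgue g) (esssup lebesgue h)"
    proof eventually_elim
      case (elim t)
      have "max (g t) (h t) \<le> max (esssup lebesgue g) (esssup lebesgue h)"
        using elim by (intro max.mono)
      then show ?case
        using elim(1) by (meson mult_left_mono order_trans zero_le)
    qed
    then show ?thesis
      unfolding True Lp_norm_top using f
      by (subst esssup_lebesgue_le_iff) (simp_all add: measurable_completion)
  qed
  then show ?thesis
    using that[of 1] by simp
next
  case False
  define q where "q = enn2real p"
  have q: "0 < q"
    using p False by (simp add: q_def enn2real_positive_iff top.not_eq_extremum)
  define K where "K = 2 powr (1 / q)"
  have "Lp_norm p f \<le> ennreal (c * K) * max (Lp_norm p g) (Lp_norm p h)"
    if [measurable]: "f \<in> borel_measurable borel" "g \<in> borel_measurable borel" "h \<in> borel_measurable borel"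
      and c: "0 \<le> c" and le: "AE t in lborel. f t \<le> ennreal c * max (g t) (h t)" for f g h c
  proof -
    let ?G = "\<integral>\<^sup>+t. ennreal_powr (g t) q \<partial>lborel" and ?H = "\<integral>\<^sup>+t. ennreal_powr (h t) q \<partial>lborel"
    have "(\<integral>\<^sup>+t. ennreal_powr (f t) q \<partial>lborel) \<le>
        (\<integral>\<^sup>+t. ennreal_powr (ennreal c) q * (ennreal_powr (g t) q + ennreal_powr (h t) q) \<partial>lborel)"
    proof (rule nn_integral_mono_AE, use le in eventually_elim)
      fix t assume "f t \<le> ennreal c * max (g t) (h t)"
      then have "ennreal_powr (f t) q \<le> ennreal_powr (ennreal c * max (g t) (h t)) q"
        using q by (rule ennreal_powr_mono)
      also have "\<dots> = ennreal_powr (ennreal c) q * max (ennreal_powr (g t) q) (ennreal_powr (h t) q)"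
        using q by (simp add: ennreal_powr_mult ennreal_powr_max)
      also have "\<dots> \<le> ennreal_powr (ennreal c) q * (ennreal_powr (g t) q + ennreal_powr (h t) q)"
        by (intro mult_left_mono) (auto simp: max_def)
      finally show "ennreal_powr (f t) q \<le> \<dots>" .
    qed
    also have "\<dots> = ennreal_powr (ennreal c) q * (?G + ?H)"
      by (simp add: nn_integral_cmult nn_integral_add)
    also have "\<dots> \<le> ennreal_powr (ennreal c) q * (2 * max ?G ?H)"
      by (intro mult_left_mono) (auto simp: mult_2 intro: add_mono)
    also have "\<dots> = ennreal_powr (ennreal c) q * (ennreal_powr (ennreal K) q * max ?G ?H)"
      using q by (simp add: K_def ennreal_powr_ennreal powr_powr)
    finally have "ennreal_powr (\<integral>\<^sup>+t. ennreal_powr (f t) q \<partial>lborel) (1 / q) \<le>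
        ennreal_powr (ennreal_powr (ennreal c) q * (ennreal_powr (ennreal K) q * max ?G ?H)) (1 / q)"
      using q by (intro ennreal_powr_mono) auto
    also have "\<dots> = ennreal (c * K) * max (ennreal_powr ?G (1 / q)) (ennreal_powr ?H (1 / q))"
      using q c by (simp add: ennreal_powr_mult ennreal_powr_max ennreal_powr_inverse ennreal_mult mult.assoc K_def)
    finally show ?thesis
      by (simp add: Lp_norm_finite[OF False] q_def)
  qed
  then show ?thesis
    using that[of K] by (simp add: K_def)
qed

lemma Lp_norm_cmult:
  assumes p: "0 < p" and g: "g \<in> borel_measurable borel" and c: "0 \<le> c"
  shows "Lp_norm p (\<lambda>t. ennreal c * g t) = ennreal c * Lp_norm p g"
proof (cases "p = \<infinity>")
  case True
  have le: "esssup lebesgue (\<lambda>t. ennreal r * f t) \<le> ennreal r * esssup lebesgue f"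
    if f: "f \<in> borel_measurable borel" for r f
  proof (rule esssup_I)
    show "(\<lambda>t. ennreal r * f t) \<in> borel_measurable lebesgue"
      using f by (simp add: measurable_completion)
    show "AE t in lebesgue. ennreal r * f t \<le> ennreal r * esssup lebesgue f"
      using esssup_AE[of f lebesgue] by (rule eventually_mono) (auto intro: mult_left_mono)
  qed
  have "ennreal c * esssup lebesgue g \<le> esssup lebesgue (\<lambda>t. ennreal c * g t)"
  proof (cases "c = 0")
    case False
    with c have inv: "ennreal c * ennreal (1 / c) = 1" "ennreal (1 / c) * ennreal c = 1"
      by (simp_all flip: ennreal_mult')
    have "(\<lambda>t. ennreal c * g t) \<in> borel_measurable borel"
      using g by measurable
    from le[OF this, of "1 / c"] have "esssup lebesgue g \<le> ennreal (1 / c) * esssup lebesgue (\<lambda>t. ennreal c * g t)"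
      by (simp add: inv flip: mult.assoc)
    then have "ennreal c * esssup lebesgue g \<le> ennreal c * (ennreal (1 / c) * esssup lebesgue (\<lambda>t. ennreal c * g t))"
      by (rule mult_left_mono) simp
    then show ?thesis
      by (simp add: inv flip: mult.assoc)
  qed simp
  then show ?thesis
    unfolding True Lp_norm_top by (rule antisym[OF le[OF g]])
next
  case False
  note [measurable] = g
  have "0 < enn2real p"
    using p False by (simp add: enn2real_positive_iff top.not_eq_extremum)
  then show ?thesis
    by (simp add: Lp_norm_finite[OF False] ennreal_powr_mult nn_integral_cmult ennreal_powr_inverse)
qed

section \<open>Iterated quasi-norms\<close>

text \<open>
  Coordinate vectors are indexed by all natural numbers, so that one measurable space serves at every stage of
  the iteration, whatever the number of coordinates already integrated.
\<close>

abbreviation coordinates :: "(nat \<Rightarrow> real) measure" where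
  "coordinates \<equiv> \<Pi>\<^sub>M i\<in>UNIV. borel"

text \<open>
  The recursion of \<^const>\<open>mixed_iter\<close> for an arbitrary function of the coordinates, which need
  not come from a function on the Euclidean space.
\<close>

primrec iterated_norm ::
    "(nat \<Rightarrow> ennreal) \<Rightarrow> ((nat \<Rightarrow> real) \<Rightarrow> ennreal) \<Rightarrow> nat \<Rightarrow> (nat \<Rightarrow> real) \<Rightarrow> ennreal" where
  "iterated_norm p F 0 = F"
| "iterated_norm p F (Suc k) = (\<lambda>x. Lp_norm (p k) (\<lambda>t. iterated_norm p F k (x(k := t))))"

text \<open>
  The notion of almost everywhere matching the iteration: the exceptional set of \<open>x k\<close> may depend
  on the later coordinates.
\<close>

primrec iterated_AE :: "((nat \<Rightarrow> real) \<Rightarrow> bool) \<Rightarrow> nat \<Rightarrow> (nat \<Rightarrow> real) \<Rightarrow> bool" where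
  "iterated_AE P 0 = P"
| "iterated_AE P (Suc k) = (\<lambda>x. AE t in lborel. iterated_AE P k (x(k := t)))"

lemma mixed_norm_eq_iterated_norm:
  "mixed_norm e p f =
    iterated_norm p (\<lambda>x. ennreal (norm (f (\<Sum>i<DIM('a). x i *\<^sub>R e i)))) DIM('a) (\<lambda>_. 0)"
  for e :: "nat \<Rightarrow> 'a::euclidean_space"
proof -
  have "mixed_iter e p f k = iterated_norm p (\<lambda>x. ennreal (norm (f (\<Sum>i<DIM('a). x i *\<^sub>R e i)))) k" for k
    by (induction k) simp_all
  then show ?thesis
    by (simp add: mixed_norm_def)
qed

lemma iterated_AE_I: "(\<And>x. P x) \<Longrightarrow> iterated_AE P k x"
  by (induction k arbitrary: x) simp_all

lemma iterated_AE_mp: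
  "iterated_AE P k x \<Longrightarrow> iterated_AE (\<lambda>x. P x \<longrightarrow> Q x) k x \<Longrightarrow> iterated_AE Q k x"
proof (induction k arbitrary: x)
  case (Suc k)
  have "AE t in lborel. iterated_AE P k (x(k := t))" "AE t in lborel. iterated_AE (\<lambda>x. P x \<longrightarrow> Q x) k (x(k := t))"
    using Suc.prems by simp_all
  then have "AE t in lborel. iterated_AE Q k (x(k := t))"
    by eventually_elim (rule Suc.IH)
  then show ?case
    by simp
qed simp

lemma measurable_coordinate_update: "(\<lambda>(x, t). x(k := t)) \<in> measurable (coordinates \<Otimes>\<^sub>M borel) coordinates"
  unfolding split_beta by (rule measurable_fun_upd[where J = UNIV]) auto

lemma measurable_coordinate_update_const: "(\<lambda>t. x(k := t)) \<in> measurable borel coordinates"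
  by (rule measurable_fun_upd[where J = UNIV]) (auto simp: space_PiM)

lemma borel_measurable_iterated_norm:
  assumes F: "F \<in> borel_measurable coordinates"
  shows "iterated_norm p F k \<in> borel_measurable coordinates"
proof (induction k)
  case (Suc k)
  have "(\<lambda>(x, t). iterated_norm p F k (x(k := t))) \<in> borel_measurable (coordinates \<Otimes>\<^sub>M borel)"
    using measurable_compose[OF measurable_coordinate_update Suc, of k] unfolding split_beta .
  then show ?case
    by (simp add: borel_measurable_Lp_norm)
qed (simp add: F)

lemma borel_measurable_iterated_norm_update:
  assumes "F \<in> borel_measurable coordinates"
  shows "(\<lambda>t. iterated_norm p F k (x(k := t))) \<in> borel_measurable borel"
  using measurable_compose[OF measurable_coordinate_update_const borel_measurable_iterated_norm[OF assms]] .

lemma iterated_norm_cong_AE: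
  assumes F: "F \<in> borel_measurable coordinates"
  shows "iterated_AE (\<lambda>x. G x = F x) k x \<Longrightarrow> iterated_norm p G k x = iterated_norm p F k x"
proof (induction k arbitrary: x)
  case (Suc k)
  then have "AE t in lborel. iterated_norm p G k (x(k := t)) = iterated_norm p F k (x(k := t))"
    by (auto elim!: eventually_mono)
  then show ?case
    using borel_measurable_iterated_norm_update[OF F] by (simp add: Lp_norm_cong_AE)
qed simp

text \<open>
  The constants of \<open>Lp_norm_max_le\<close> multiply along the iteration.
\<close>

lemma iterated_norm_max_le:
  assumes p: "\<And>i. i < k \<Longrightarrow> 0 < p i"
  obtains K :: real where "0 \<le> K"
    "\<And>F G H c x. \<lbrakk>F \<in> borel_measurable coordinates; G \<in> borel_measurable coordinates;
      H \<in> borel_measurable coordinates; 0 \<le> c;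
      iterated_AE (\<lambda>x. F x \<le> ennreal c * max (G x) (H x)) k x\<rbrakk> \<Longrightarrow>
      iterated_norm p F k x \<le> ennreal (c * K) * max (iterated_norm p G k x) (iterated_norm p H k x)"
  using p
proof (induction k arbitrary: thesis)
  case 0
  show ?case
    by (rule 0(1)[of 1]) auto
next
  case (Suc k)
  show ?case
  proof (rule Suc.IH)
    show "0 < p i" if "i < k" for i
      using that Suc.prems(2) by simp
    fix K :: real
    assume K: "0 \<le> K"
      "\<And>F G H c x. \<lbrakk>F \<in> borel_measurable coordinates; G \<in> borel_measurable coordinates;
        H \<in> borel_measurable coordinates; 0 \<le> c;
        iterated_AE (\<lambda>x. F x \<le> ennreal c * max (G x) (H x)) k x\<rbrakk> \<Longrightarrow>
        iterated_norm p F k x \<le> ennreal (c * K) * max (iterated_norm p G k x) (iterated_norm p H k x)"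
    obtain L where L: "0 \<le> L"
      "\<And>f g h c. \<lbrakk>f \<in> borel_measurable borel; g \<in> borel_measurable borel; h \<in> borel_measurable borel;
        0 \<le> c; AE t in lborel. f t \<le> ennreal c * max (g t) (h t)\<rbrakk> \<Longrightarrow>
        Lp_norm (p k) f \<le> ennreal (c * L) * max (Lp_norm (p k) g) (Lp_norm (p k) h)"
      by (rule Lp_norm_max_le[of "p k"]) (use Suc.prems(2) in auto)
    show thesis
    proof (rule Suc.prems(1)[of "K * L"])
      fix F G H c x
      assume F: "F \<in> borel_measurable coordinates" and G: "G \<in> borel_measurable coordinates"
        and H: "H \<in> borel_measurable coordinates" and c: "0 \<le> c"
        and le: "iterated_AE (\<lambda>x. F x \<le> ennreal c * max (G x) (H x)) (Suc k) x"
      have "AE t in lborel. iterated_norm p F k (x(k := t)) \<le>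
          ennreal (c * K) * max (iterated_norm p G k (x(k := t))) (iterated_norm p H k (x(k := t)))"
        using le K(2)[OF F G H c] by (auto elim!: eventually_mono)
      then have "iterated_norm p F (Suc k) x \<le>
          ennreal (c * K * L) * max (iterated_norm p G (Suc k) x) (iterated_norm p H (Suc k) x)"
        using F G H c K(1) by (auto intro!: L(2) borel_measurable_iterated_norm_update)
      then show "iterated_norm p F (Suc k) x \<le>
          ennreal (c * (K * L)) * max (iterated_norm p G (Suc k) x) (iterated_norm p H (Suc k) x)"
        by (simp add: mult.assoc)
    qed (use K L in simp)
  qed
qed

lemma iterated_norm_prod:
  assumes p: "\<And>i. i < n \<Longrightarrow> 0 < p i"
    and u: "\<And>i. i < n \<Longrightarrow> (\<lambda>t. ennreal (u i t)) \<in> borel_measurable borel" "\<And>i t. 0 \<le> u i t"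
    and fin: "\<And>i. i < n \<Longrightarrow> Lp_norm (p i) (\<lambda>t. ennreal (u i t)) < \<infinity>"
  shows "k \<le> n \<Longrightarrow> iterated_norm p (\<lambda>x. \<Prod>i<n. ennreal (u i (x i))) k x =
    (\<Prod>i<k. Lp_norm (p i) (\<lambda>t. ennreal (u i t))) * (\<Prod>i\<in>{k..<n}. ennreal (u i (x i)))"
proof (induction k arbitrary: x)
  case 0
  show ?case
    by (simp add: lessThan_atLeast0)
next
  case (Suc k)
  define c where "c = (\<Prod>i<k. Lp_norm (p i) (\<lambda>t. ennreal (u i t))) * (\<Prod>i\<in>{Suc k..<n}. ennreal (u i (x i)))"
  have "c < \<infinity>"
    unfolding c_def using fin Suc.prems
    by (auto simp: less_top[symmetric] ennreal_mult_eq_top_iff ennreal_prod_eq_top)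
  then have c: "ennreal (enn2real c) = c"
    by simp
  have "iterated_norm p (\<lambda>x. \<Prod>i<n. ennreal (u i (x i))) k (x(k := t)) = c * ennreal (u k t)" for t
  proof -
    have "{k..<n} = insert k {Suc k..<n}"
      using Suc.prems by auto
    then show ?thesis
      using Suc.prems by (auto simp: Suc.IH c_def mult_ac intro!: prod.cong)
  qed
  then have "iterated_norm p (\<lambda>x. \<Prod>i<n. ennreal (u i (x i))) (Suc k) x =
      Lp_norm (p k) (\<lambda>t. ennreal (enn2real c) * ennreal (u k t))"
    by (simp add: c)
  also have "\<dots> = ennreal (enn2real c) * Lp_norm (p k) (\<lambda>t. ennreal (u k t))"
    using Suc.prems by (intro Lp_norm_cmult p u) auto
  finally show ?case
    by (simp add: c) (simp add: c_def mult_ac)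
qed

text \<open>
  For finite \<open>p\<close> the \<open>p\<close>-th power is a multiple of a normal density with mean
  \<open>s\<close> and variance \<open>1 / (2 b p)\<close>, so its integral does not depend on \<open>s\<close>.
  For \<open>p = \<infinity>\<close> the values on \<open>{s..s + 1}\<close> give the lower bound.
\<close>

lemma Lp_norm_gaussian:
  assumes p: "0 < p" and b: "0 < b"
  obtains m M :: real where "0 < m"
    "\<And>s. ennreal m \<le> Lp_norm p (\<lambda>t. ennreal (exp (- (b * (t - s)\<^sup>2))))"
    "\<And>s. Lp_norm p (\<lambda>t. ennreal (exp (- (b * (t - s)\<^sup>2)))) \<le> ennreal M"
proof (cases "p = \<infinity>")
  case True
  have meas: "(\<lambda>t. ennreal (exp (- (b * (t - s)\<^sup>2)))) \<in> borel_measurable lebesgue" for s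
    by (intro measurable_completion) simp
  show ?thesis
  proof (rule that[of "exp (- b)" 1])
    fix s
    show "Lp_norm p (\<lambda>t. ennreal (exp (- (b * (t - s)\<^sup>2)))) \<le> ennreal 1"
      unfolding True Lp_norm_top by (subst esssup_lebesgue_le_iff[OF meas]) (use b in auto)
    show "ennreal (exp (- b)) \<le> Lp_norm p (\<lambda>t. ennreal (exp (- (b * (t - s)\<^sup>2))))"
    proof (rule ccontr)
      assume "\<not> ?thesis"
      then have "Lp_norm p (\<lambda>t. ennreal (exp (- (b * (t - s)\<^sup>2)))) < ennreal (exp (- b))"
        by simp
      moreover have "AE t in lborel. ennreal (exp (- (b * (t - s)\<^sup>2))) \<le> Lp_norm p (\<lambda>t. ennreal (exp (- (b * (t - s)\<^sup>2))))"
        unfolding True Lp_norm_top using esssup_lebesgue_le_iff[OF meas] by blast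
      ultimately have "AE t in lborel. exp (- (b * (t - s)\<^sup>2)) < exp (- b)"
        by (auto elim!: eventually_mono simp: ennreal_less_iff dest: le_less_trans)
      then have "AE t in lborel. t \<notin> {s..s + 1}"
      proof eventually_elim
        case (elim t)
        then have "1 < (t - s)\<^sup>2"
          using b by simp
        then show ?case
          using power_le_one[of "t - s" 2] by auto
      qed
      then have "emeasure lborel {s..s + 1} = 0"
        by (intro AE_iff_measurable[THEN iffD1, of _ _ "\<lambda>t. t \<notin> {s..s + 1}"]) auto
      then show False
        by simp
    qed
  qed simp
next
  case False
  define q where "q = enn2real p"
  have q: "0 < q"
    using p False by (simp add: q_def enn2real_positive_iff top.not_eq_extremum)
  define \<sigma> where "\<sigma> = sqrt (1 / (2 * (b * q)))"
  have \<sigma>: "0 < \<sigma>" "\<sigma>\<^sup>2 = 1 / (2 * (b * q))"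
    using b q by (simp_all add: \<sigma>_def)
  define A where "A = sqrt (2 * pi * \<sigma>\<^sup>2)"
  have A: "0 < A"
    using \<sigma>(1) by (simp add: A_def)
  have "Lp_norm p (\<lambda>t. ennreal (exp (- (b * (t - s)\<^sup>2)))) = ennreal (A powr (1 / q))" for s
  proof -
    have "(\<integral>\<^sup>+t. ennreal_powr (ennreal (exp (- (b * (t - s)\<^sup>2)))) q \<partial>lborel) =
        (\<integral>\<^sup>+t. ennreal A * ennreal (normal_density s \<sigma> t) \<partial>lborel)"
    proof (intro nn_integral_cong)
      fix t
      have "exp (- (b * (t - s)\<^sup>2)) powr q = A * normal_density s \<sigma> t"
        using A b q by (simp add: exp_powr_real normal_density_def \<sigma>(2) A_def mult_ac)
      then show "ennreal_powr (ennreal (exp (- (b * (t - s)\<^sup>2)))) q = ennreal A * ennreal (normal_density s \<sigma> t)"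
        using A by (simp add: ennreal_powr_ennreal ennreal_mult)
    qed
    also have "\<dots> = ennreal A * 1"
      using \<sigma>(1) by (subst nn_integral_cmult) (auto simp: nn_integral_eq_integral)
    finally show ?thesis
      using A by (simp add: Lp_norm_finite[OF False] ennreal_powr_ennreal flip: q_def)
  qed
  then show ?thesis
    using that[of "A powr (1 / q)" "A powr (1 / q)"] A by simp
qed

section \<open>Null sets and mixed norms in the coordinates of a basis\<close>

text \<open>
  The basis \<open>e\<close> is the image of the standard orthonormal basis, enumerated as \<open>j\<close>,
  under a linear isomorphism \<open>T\<close>; this transfers null sets and norm estimates from Cartesian
  coordinates.
\<close>

lemma ordered_basis_coordinates:
  fixes e :: "nat \<Rightarrow> 'a::euclidean_space"
  assumes e: "ordered_basis e"
  obtains j :: "nat \<Rightarrow> 'a" and T :: "'a \<Rightarrow> 'a" where "bij_betw j {..<DIM('a)} Basis" "linear T" "inj T"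
    "\<And>x. T (\<Sum>i<DIM('a). x i *\<^sub>R j i) = (\<Sum>i<DIM('a). x i *\<^sub>R e i)"
    "\<And>x. (norm (\<Sum>i<DIM('a). x i *\<^sub>R j i))\<^sup>2 = (\<Sum>i<DIM('a). (x i)\<^sup>2)"
proof -
  obtain j :: "nat \<Rightarrow> 'a" where j: "bij_betw j {..<DIM('a)} Basis"
    using ex_bij_betw_nat_finite[OF finite_Basis] by (auto simp: lessThan_atLeast0)
  have j_inner: "j i \<bullet> j k = (if i = k then 1 else 0)" if "i < DIM('a)" "k < DIM('a)" for i k
  proof -
    have "j i \<in> Basis" "j k \<in> Basis" "j i = j k \<longleftrightarrow> i = k"
      using j that by (auto simp: bij_betw_def inj_on_def)
    then show ?thesis
      by (simp add: inner_Basis)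
  qed
  have coord: "(\<Sum>i<DIM('a). x i *\<^sub>R j i) \<bullet> j k = x k" if "k < DIM('a)" for x k
  proof -
    have "(\<Sum>i<DIM('a). x i *\<^sub>R j i) \<bullet> j k = (\<Sum>i<DIM('a). if i = k then x i else 0)"
      unfolding inner_sum_left by (intro sum.cong) (auto simp: j_inner that)
    then show ?thesis
      using that by simp
  qed
  define T where "T = (\<lambda>z. \<Sum>i<DIM('a). (z \<bullet> j i) *\<^sub>R e i)"
  have lin: "linear T"
    unfolding T_def by (intro linearI) (simp_all add: inner_add_left scaleR_add_left sum.distrib scaleR_sum_right)
  have "inj T"
  proof (subst linear_injective_0[OF lin], intro allI impI)
    fix z assume "T z = 0"
    have inj: "inj_on e {..<DIM('a)}" and ind: "independent (e ` {..<DIM('a)})"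
      using e by (auto simp: ordered_basis_def)
    define u where "u = (\<lambda>v. z \<bullet> j (inv_into {..<DIM('a)} e v))"
    have "(\<Sum>v\<in>e ` {..<DIM('a)}. u v *\<^sub>R v) = T z"
      unfolding T_def u_def using inj by (subst sum.reindex) auto
    with \<open>T z = 0\<close> have "u (e i) = 0" if "i < DIM('a)" for i
      using independentD[OF ind _ subset_refl, of u "e i"] that by simp
    then have "z \<bullet> j i = 0" if "i < DIM('a)" for i
      using that inj by (simp add: u_def)
    moreover have "\<exists>i<DIM('a). b = j i" if "b \<in> Basis" for b
      using that bij_betw_imp_surj_on[OF j] by blast
    ultimately have "z \<bullet> b = 0" if "b \<in> Basis" for b
      using that by blast
    then show "z = 0"
      using euclidean_all_zero_iff by blast
  qed
  moreover have "T (\<Sum>i<DIM('a). x i *\<^sub>R j i) = (\<Sum>i<DIM('a). x i *\<^sub>R e i)" for x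
    unfolding T_def by (intro sum.cong refl) (simp add: coord)
  moreover have "(norm (\<Sum>i<DIM('a). x i *\<^sub>R j i))\<^sup>2 = (\<Sum>i<DIM('a). (x i)\<^sup>2)" for x
  proof -
    have "(norm (\<Sum>i<DIM('a). x i *\<^sub>R j i))\<^sup>2 = (\<Sum>k<DIM('a). x k * ((\<Sum>i<DIM('a). x i *\<^sub>R j i) \<bullet> j k))"
      by (simp add: power2_norm_eq_inner inner_sum_right)
    then show ?thesis
      by (simp add: coord power2_eq_square)
  qed
  ultimately show ?thesis
    using that[OF j lin] by blast
qed

text \<open>
  Fubini's theorem, one coordinate at a time.  The product measure lives on the image of \<open>j\<close>,
  because the Lebesgue measure of a Euclidean space is a product indexed by its unordered basis, while the
  iteration needs the order of the indices.
\<close>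

lemma iterated_AE_PiM:
  fixes j :: "nat \<Rightarrow> 'b"
  assumes j: "inj_on j {..<n}" and Q: "{x. Q x} \<in> sets coordinates"
  shows "k \<le> n \<Longrightarrow> AE y in \<Pi>\<^sub>M b\<in>j ` {..<k}. lborel. Q (\<lambda>i. if i < k then y (j i) else x i) \<Longrightarrow>
    iterated_AE Q k x"
proof (induction k arbitrary: x)
  case 0
  then show ?case
    unfolding lessThan_0 image_empty PiM_empty by (simp add: AE_count_space)
next
  case (Suc k)
  interpret product_sigma_finite "\<lambda>_::'b. lborel :: real measure" ..
  define I where "I = j ` {..<k}"
  have distinct: "j k \<noteq> j i" if "i < k" for i
    using inj_onD[OF j, of k i] that Suc.prems(1) by auto
  have I: "j ` {..<Suc k} = insert (j k) I" "finite I" "j k \<notin> I"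
    using distinct by (auto simp: I_def lessThan_Suc)
  interpret I: sigma_finite_measure "\<Pi>\<^sub>M b\<in>I. (lborel :: real measure)"
    by (rule sigma_finite[OF I(2)])
  define f :: "('b \<Rightarrow> real) \<Rightarrow> ennreal" where
    "f y = indicator (- {x. Q x}) (\<lambda>i. if i < Suc k then y (j i) else x i)" for y
  have "(\<lambda>y i. if i < Suc k then y (j i) else x i) \<in> measurable (\<Pi>\<^sub>M b\<in>insert (j k) I. lborel) coordinates"
  proof (rule measurable_PiM_single')
    fix i :: nat
    show "(\<lambda>y. if i < Suc k then y (j i) else x i) \<in> borel_measurable (\<Pi>\<^sub>M b\<in>insert (j k) I. lborel)"
    proof (cases "i < Suc k")
      case True
      then have "j i \<in> insert (j k) I"
        by (auto simp: I_def less_Suc_eq)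
      then have "(\<lambda>y. y (j i)) \<in> measurable (\<Pi>\<^sub>M b\<in>insert (j k) I. lborel) (lborel :: real measure)"
        by (rule measurable_component_singleton)
      with True show ?thesis
        by simp
    qed simp
  qed simp
  moreover have "(indicator (- {x. Q x}) :: _ \<Rightarrow> ennreal) \<in> borel_measurable coordinates"
    using sets.compl_sets[OF Q] by (intro borel_measurable_indicator) (simp add: space_PiM Compl_eq_Diff_UNIV)
  ultimately have f: "f \<in> borel_measurable (\<Pi>\<^sub>M b\<in>insert (j k) I. lborel)"
    unfolding f_def by (rule measurable_compose)
  have upd: "(\<lambda>(t, y). y(j k := t)) \<in> measurable (lborel \<Otimes>\<^sub>M (\<Pi>\<^sub>M b\<in>I. lborel)) (\<Pi>\<^sub>M b\<in>insert (j k) I. (lborel :: real measure))"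
    unfolding split_beta by (rule measurable_fun_upd[where J = I]) auto
  have f2: "(\<lambda>(t, y). f (y(j k := t))) \<in> borel_measurable (lborel \<Otimes>\<^sub>M (\<Pi>\<^sub>M b\<in>I. lborel))"
    using measurable_compose[OF upd f] unfolding split_beta .
  have f3: "(\<lambda>y. f (y(j k := t))) \<in> borel_measurable (\<Pi>\<^sub>M b\<in>I. lborel)" for t
    using measurable_compose[OF measurable_Pair1' f2, of t] by simp
  have "AE y in \<Pi>\<^sub>M b\<in>insert (j k) I. lborel. f y = 0"
    using Suc.prems(2) unfolding I(1) f_def by (auto elim!: eventually_mono)
  then have "(\<integral>\<^sup>+t. \<integral>\<^sup>+y. f (y(j k := t)) \<partial>(\<Pi>\<^sub>M b\<in>I. lborel) \<partial>lborel) = 0"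
    using product_nn_integral_insert_rev[OF I(2,3) f] nn_integral_0_iff_AE[OF f] by simp
  then have "AE t in lborel. (\<integral>\<^sup>+y. f (y(j k := t)) \<partial>(\<Pi>\<^sub>M b\<in>I. lborel)) = 0"
    by (subst (asm) nn_integral_0_iff_AE) (use I.borel_measurable_nn_integral[OF f2] in simp_all)
  then have "AE t in lborel. iterated_AE Q k (x(k := t))"
  proof eventually_elim
    case (elim t)
    then have "AE y in \<Pi>\<^sub>M b\<in>I. lborel. f (y(j k := t)) = 0"
      using nn_integral_0_iff_AE[OF f3] by simp
    then have "AE y in \<Pi>\<^sub>M b\<in>I. lborel. Q (\<lambda>i. if i < k then y (j i) else (x(k := t)) i)"
    proof eventually_elim
      case (elim y)
      have "(\<lambda>i. if i < Suc k then (y(j k := t)) (j i) else x i) = (\<lambda>i. if i < k then y (j i) else (x(k := t)) i)"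
        using distinct by (fastforce simp: fun_eq_iff less_Suc_eq)
      then have "f (y(j k := t)) = indicator (- {x. Q x}) (\<lambda>i. if i < k then y (j i) else (x(k := t)) i)"
        by (simp add: f_def)
      with elim show ?case
        by (simp add: indicator_def split: if_splits)
    qed
    then show ?case
      unfolding I_def by (rule Suc.IH[rotated]) (use Suc.prems(1) in simp)
  qed
  then show ?case
    by simp
qed

lemma measurable_coordinates_sum:
  fixes e :: "nat \<Rightarrow> 'a::euclidean_space"
  shows "(\<lambda>x. \<Sum>i<n. x i *\<^sub>R e i) \<in> borel_measurable coordinates"
  by (intro borel_measurable_sum borel_measurable_scaleR measurable_component_singleton) auto

text \<open>
  The linear isomorphism \<open>T\<close> maps Cartesian coordinates to those of \<open>e\<close>, and its
  inverse preserves null sets.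
\<close>

lemma iterated_AE_of_AE:
  fixes e :: "nat \<Rightarrow> 'a::euclidean_space"
  assumes e: "ordered_basis e" and P: "AE z in lborel. P z"
  shows "iterated_AE (\<lambda>x. P (\<Sum>i<DIM('a). x i *\<^sub>R e i)) DIM('a) x"
proof -
  obtain j T where j: "bij_betw j {..<DIM('a)} (Basis :: 'a set)" and T: "linear T" "inj T"
    and Te: "\<And>x. T (\<Sum>i<DIM('a). x i *\<^sub>R j i) = (\<Sum>i<DIM('a). x i *\<^sub>R e i)"
    using ordered_basis_coordinates[OF e] by metis
  obtain S where S: "\<And>z. z \<notin> S \<Longrightarrow> P z" "S \<in> null_sets lborel"
    using AE_E3[OF P] by auto
  obtain T' where T': "linear T'" "\<And>z. T' (T z) = z" "\<And>z. T (T' z) = z"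
    using linear_injective_isomorphism[OF T] by blast
  have "T -` S = T' ` S"
    using T'(2,3) by (auto simp: image_iff) metis
  moreover have "negligible (T' ` S)"
    using S(2) T'(1) by (intro negligible_differentiable_image_negligible)
      (auto simp: negligible_iff_null_sets intro: null_sets_completionI linear_imp_differentiable_on)
  moreover have "T -` S \<in> sets lborel"
  proof -
    have "T \<in> borel_measurable borel"
      using T(1) by (intro borel_measurable_continuous_onI linear_continuous_on) (simp add: linear_conv_bounded_linear)
    then show ?thesis
      using S(2) measurable_sets_borel[of T borel S] by auto
  qed
  ultimately have "T -` S \<in> null_sets lborel"
    by (simp add: negligible_iff_null_sets null_sets_completion_iff)
  then have "AE z in lborel. T z \<notin> S"
    using AE_not_in[of "T -` S" lborel] by simp
  then have "AE z in distr (\<Pi>\<^sub>M b\<in>Basis. lborel) borel (\<lambda>f. \<Sum>b\<in>Basis. f b *\<^sub>R b). T z \<notin> S"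
    unfolding lborel_eq[where 'a = 'a] .
  then have "AE y in \<Pi>\<^sub>M b\<in>Basis. lborel. T (\<Sum>b\<in>Basis. y b *\<^sub>R b) \<notin> S"
    by (rule AE_distrD[rotated]) measurable
  moreover have "T (\<Sum>b\<in>Basis. y b *\<^sub>R b) = (\<Sum>i<DIM('a). y (j i) *\<^sub>R e i)" for y
    using sum.reindex_bij_betw[OF j, of "\<lambda>b. y b *\<^sub>R b"] Te[of "\<lambda>i. y (j i)"] by simp
  ultimately have "AE y in \<Pi>\<^sub>M b\<in>j ` {..<DIM('a)}. lborel. (\<Sum>i<DIM('a). y (j i) *\<^sub>R e i) \<notin> S"
    unfolding bij_betw_imp_surj_on[OF j] by simp
  then have "AE y in \<Pi>\<^sub>M b\<in>j ` {..<DIM('a)}. lborel.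
      (\<Sum>i<DIM('a). (if i < DIM('a) then y (j i) else x i) *\<^sub>R e i) \<notin> S"
    by simp
  moreover have "{x. (\<Sum>i<DIM('a). x i *\<^sub>R e i) \<notin> S} \<in> sets coordinates"
  proof -
    have "- S \<in> sets borel"
      using S(2) by (auto simp: null_sets_def)
    from measurable_sets[OF measurable_coordinates_sum this] show ?thesis
      by (simp add: space_PiM vimage_def)
  qed
  ultimately have "iterated_AE (\<lambda>x. (\<Sum>i<DIM('a). x i *\<^sub>R e i) \<notin> S) DIM('a) x"
    using j by (intro iterated_AE_PiM[where j = j and n = "DIM('a)"]) (auto simp: bij_betw_def)
  then show ?thesis
    by (rule iterated_AE_mp) (rule iterated_AE_I, use S(1) in blast)
qed

text \<open>
  A Lebesgue measurable function may have non-measurable sections, on which the essential supremum is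
  \<open>\<infinity>\<close>.  They occur only on iterated null sets, so that the mixed norm is that of a Borel
  function.
\<close>

lemma mixed_norm_representative:
  fixes e :: "nat \<Rightarrow> 'a::euclidean_space"
  assumes e: "ordered_basis e" and f: "f \<in> borel_measurable lebesgue"
  obtains F where "F \<in> borel_measurable coordinates"
    "mixed_norm e p f = iterated_norm p F DIM('a) (\<lambda>_. 0)"
    "\<And>x. iterated_AE (\<lambda>x. ennreal (norm (f (\<Sum>i<DIM('a). x i *\<^sub>R e i))) = F x) DIM('a) x"
proof -
  have "(\<lambda>z. ennreal (norm (f z))) \<in> borel_measurable lebesgue"
    using f by measurable
  then obtain h where h: "h \<in> borel_measurable lborel" "AE z in lborel. ennreal (norm (f z)) = h z"
    using completion_ex_borel_measurable by blast
  let ?F = "\<lambda>x. h (\<Sum>i<DIM('a). x i *\<^sub>R e i)"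
  have F: "?F \<in> borel_measurable coordinates"
    using h(1) by (intro measurable_compose[OF measurable_coordinates_sum]) simp
  have ae: "iterated_AE (\<lambda>x. ennreal (norm (f (\<Sum>i<DIM('a). x i *\<^sub>R e i))) = ?F x) DIM('a) x" for x
    by (rule iterated_AE_of_AE[OF e h(2)])
  show ?thesis
    by (rule that[OF F _ ae]) (simp add: mixed_norm_eq_iterated_norm iterated_norm_cong_AE[OF F ae])
qed

text \<open>
  With \<open>g = h\<close> this is solidity; with \<open>c = 2\<close> it controls sums and differences.
\<close>

lemma mixed_norm_max_le:
  fixes e :: "nat \<Rightarrow> 'a::euclidean_space"
  assumes e: "ordered_basis e" and p: "\<And>i. i < DIM('a) \<Longrightarrow> 0 < p i"
  obtains K :: real where "0 \<le> K"
    "\<And>f g h c. \<lbrakk>f \<in> borel_measurable lebesgue; g \<in> borel_measurable lebesgue; h \<in> borel_measurable lebesgue;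
      0 \<le> c; \<And>z. norm (f z) \<le> c * max (norm (g z)) (norm (h z))\<rbrakk> \<Longrightarrow>
      mixed_norm e p f \<le> ennreal (c * K) * max (mixed_norm e p g) (mixed_norm e p h)"
proof -
  obtain K :: real where K: "0 \<le> K"
    "\<And>F G H c x. \<lbrakk>F \<in> borel_measurable coordinates; G \<in> borel_measurable coordinates;
      H \<in> borel_measurable coordinates; 0 \<le> c;
      iterated_AE (\<lambda>x. F x \<le> ennreal c * max (G x) (H x)) DIM('a) x\<rbrakk> \<Longrightarrow>
      iterated_norm p F DIM('a) x \<le> ennreal (c * K) * max (iterated_norm p G DIM('a) x) (iterated_norm p H DIM('a) x)"
    using iterated_norm_max_le[of "DIM('a)" p, OF p] by blast
  show ?thesis
  proof (rule that[OF K(1)])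
    fix f g h :: "'a \<Rightarrow> complex" and c :: real
    assume meas: "f \<in> borel_measurable lebesgue" "g \<in> borel_measurable lebesgue" "h \<in> borel_measurable lebesgue"
      and c: "0 \<le> c" and le: "\<And>z. norm (f z) \<le> c * max (norm (g z)) (norm (h z))"
    obtain F where F: "F \<in> borel_measurable coordinates"
      "mixed_norm e p f = iterated_norm p F DIM('a) (\<lambda>_. 0)"
      "\<And>x. iterated_AE (\<lambda>x. ennreal (norm (f (\<Sum>i<DIM('a). x i *\<^sub>R e i))) = F x) DIM('a) x"
      using mixed_norm_representative[OF e meas(1)] by blast
    obtain G where G: "G \<in> borel_measurable coordinates"
      "mixed_norm e p g = iterated_norm p G DIM('a) (\<lambda>_. 0)"
      "\<And>x. iterated_AE (\<lambda>x. ennreal (norm (g (\<Sum>i<DIM('a). x i *\<^sub>R e i))) = G x) DIM('a) x"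
      using mixed_norm_representative[OF e meas(2)] by blast
    obtain H where H: "H \<in> borel_measurable coordinates"
      "mixed_norm e p h = iterated_norm p H DIM('a) (\<lambda>_. 0)"
      "\<And>x. iterated_AE (\<lambda>x. ennreal (norm (h (\<Sum>i<DIM('a). x i *\<^sub>R e i))) = H x) DIM('a) x"
      using mixed_norm_representative[OF e meas(3)] by blast
    have pointwise: "ennreal (norm (f z)) \<le> ennreal c * max (ennreal (norm (g z))) (ennreal (norm (h z)))" for z
      using ennreal_leI[OF le[of z]] c by (simp add: ennreal_mult max_def split: if_splits)
    have "iterated_AE (\<lambda>x. ennreal (norm (f (\<Sum>i<DIM('a). x i *\<^sub>R e i))) = F x \<longrightarrow>
        ennreal (norm (g (\<Sum>i<DIM('a). x i *\<^sub>R e i))) = G x \<longrightarrow>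
        ennreal (norm (h (\<Sum>i<DIM('a). x i *\<^sub>R e i))) = H x \<longrightarrow> F x \<le> ennreal c * max (G x) (H x)) DIM('a) (\<lambda>_. 0)"
      using pointwise by (intro iterated_AE_I) metis
    then have "iterated_AE (\<lambda>x. F x \<le> ennreal c * max (G x) (H x)) DIM('a) (\<lambda>_. 0)"
      by (rule iterated_AE_mp[OF H(3) iterated_AE_mp[OF G(3) iterated_AE_mp[OF F(3)]]])
    then show "mixed_norm e p f \<le> ennreal (c * K) * max (mixed_norm e p g) (mixed_norm e p h)"
      unfolding F(2) G(2) H(2) by (intro K(2) F(1) G(1) H(1) c)
  qed
qed

section \<open>Solid function spaces and their Gaussians\<close>

lemma Lr_loc_dominated:
  assumes r: "0 < r" and g: "g \<in> Lr_loc r" and h: "h \<in> Lr_loc r"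
    and f: "f \<in> borel_measurable lebesgue" and c: "0 \<le> c"
    and le: "\<And>x. norm (f x) \<le> c * max (norm (g x)) (norm (h x))"
  shows "f \<in> Lr_loc r"
proof -
  have meas [measurable]: "g \<in> borel_measurable lebesgue" "h \<in> borel_measurable lebesgue"
    using g h by (auto simp: Lr_loc_def)
  have "(\<integral>\<^sup>+x\<in>K. ennreal (norm (f x) powr r) \<partial>lebesgue) < \<infinity>" if K: "compact K" for K
  proof -
    have [measurable]: "K \<in> sets lebesgue"
      using K by (simp add: borel_compact)
    let ?I = "\<lambda>u. \<integral>\<^sup>+x\<in>K. ennreal (norm (u x) powr r) \<partial>lebesgue"
    have "norm (f x) powr r \<le> c powr r * (norm (g x) powr r + norm (h x) powr r)" for x
    proof -
      have "norm (f x) powr r \<le> (c * max (norm (g x)) (norm (h x))) powr r"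
        using le r by (intro powr_mono2) auto
      also have "\<dots> = c powr r * max (norm (g x)) (norm (h x)) powr r"
        using c by (simp add: powr_mult)
      also have "\<dots> \<le> c powr r * (norm (g x) powr r + norm (h x) powr r)"
        by (intro mult_left_mono) (auto simp: max_def)
      finally show ?thesis .
    qed
    then have "?I f \<le> (\<integral>\<^sup>+x. ennreal (c powr r) * (ennreal (norm (g x) powr r) * indicator K x +
        ennreal (norm (h x) powr r) * indicator K x) \<partial>lebesgue)"
      by (intro nn_integral_mono)
        (auto simp: indicator_def simp flip: ennreal_plus ennreal_mult' intro!: ennreal_leI)
    also have "\<dots> = ennreal (c powr r) * (?I g + ?I h)"
      by (subst nn_integral_cmult, measurable) (subst nn_integral_add, auto)
    also have "\<dots> < \<infinity>"
      using g h K by (auto simp: Lr_loc_def ennreal_mult_less_top)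
    finally show ?thesis .
  qed
  with f show ?thesis
    by (simp add: Lr_loc_def)
qed

lemma bounded_continuous_in_Lr_loc:
  assumes f: "continuous_on UNIV f" and bound: "\<And>x. norm (f x) \<le> 1" and r: "0 < r"
  shows "f \<in> Lr_loc r"
proof -
  have "(\<integral>\<^sup>+x\<in>K. ennreal (norm (f x) powr r) \<partial>lebesgue) < \<infinity>" if K: "compact K" for K
  proof -
    have "(\<integral>\<^sup>+x\<in>K. ennreal (norm (f x) powr r) \<partial>lebesgue) \<le> (\<integral>\<^sup>+x. indicator K x \<partial>lebesgue)"
      using bound r by (intro nn_integral_mono) (auto simp: indicator_def powr_le1)
    also have "\<dots> = emeasure lborel K"
      using K by (simp add: borel_compact)
    also have "\<dots> < \<infinity>"
      using K by (intro emeasure_bounded_finite compact_imp_bounded)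
    finally show ?thesis .
  qed
  then show ?thesis
    using borel_measurable_continuous_onI[OF f] by (simp add: Lr_loc_def measurable_completion)
qed

text \<open>
  The common ground of both kinds of spaces.  The factor \<open>c\<close> in \<open>solid\<close> takes the
  place of homogeneity: it accounts for the size of the weights and of the test functions.
\<close>

locale solid_function_space =
  fixes B :: "('a::euclidean_space \<Rightarrow> complex) set"
    and N :: "('a \<Rightarrow> complex) \<Rightarrow> real"
  assumes mem_measurable: "f \<in> B \<Longrightarrow> f \<in> borel_measurable lebesgue"
    and diff_mem: "f \<in> B \<Longrightarrow> g \<in> B \<Longrightarrow> (\<lambda>x. f x - g x) \<in> B"
    and solid: "\<exists>K>0. \<forall>f g c. g \<in> B \<longrightarrow> f \<in> borel_measurable lebesgue \<longrightarrow> 0 \<le> c \<longrightarrow>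
      (\<forall>x. norm (f x) \<le> c * norm (g x)) \<longrightarrow> f \<in> B \<and> N f \<le> K * c * N g"

definition gaussian_at :: "real \<Rightarrow> 'a::euclidean_space \<Rightarrow> 'a \<Rightarrow> complex" where
  "gaussian_at a X Y = of_real (exp (- (a * (norm (Y - X))\<^sup>2)))"

text \<open>
  A weak form of translation invariance, tested on Gaussians of every width.
\<close>

definition gaussians_uniform :: "('a::euclidean_space \<Rightarrow> complex) set \<Rightarrow> (('a \<Rightarrow> complex) \<Rightarrow> real) \<Rightarrow> bool" where
  "gaussians_uniform B N \<longleftrightarrow> (\<forall>a>0. \<exists>m>0. \<exists>M. \<forall>X. gaussian_at a X \<in> B \<and>
     m \<le> N (gaussian_at a X) \<and> N (gaussian_at a X) \<le> M)"

lemma continuous_gaussian_at: "continuous_on UNIV (gaussian_at a X)"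
  unfolding gaussian_at_def by (intro continuous_intros)

lemma invariant_BF_space_imp_solid:
  assumes "invariant_BF_space B N v"
  shows "solid_function_space B N"
proof -
  interpret invariant_BF_space B N v by fact
  show ?thesis
  proof
    show "f \<in> borel_measurable lebesgue" if "f \<in> B" for f
      using that subset_L1_loc by (auto simp: Lr_loc_def)
    show "(\<lambda>x. f x - g x) \<in> B" if "f \<in> B" "g \<in> B" for f g
      using add_mem[OF that(1) scale_mem[OF that(2), of "- 1"]] by simp
    obtain C where C: "\<And>f g. f \<in> Lr_loc 1 \<Longrightarrow> g \<in> B \<Longrightarrow> (AE x in lebesgue. norm (f x) \<le> norm (g x)) \<Longrightarrow>
        f \<in> B \<and> N f \<le> C * N g"
      using invariant_solid by blast
    have "f \<in> B \<and> N f \<le> (\<bar>C\<bar> + 1) * c * N g"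
      if g: "g \<in> B" and f: "f \<in> borel_measurable lebesgue" and c: "0 \<le> c"
        and le: "\<And>x. norm (f x) \<le> c * norm (g x)" for f g c
    proof -
      have "g \<in> Lr_loc 1"
        using g subset_L1_loc by auto
      then have "f \<in> Lr_loc 1"
        by (rule Lr_loc_dominated[of 1 g g f c, rotated]) (use f c le \<open>g \<in> Lr_loc 1\<close> in auto)
      then have "f \<in> B \<and> N f \<le> C * N (\<lambda>x. of_real c * g x)"
        using le c by (intro C scale_mem g) (auto simp: norm_mult)
      moreover have "C * (c * N g) \<le> (\<bar>C\<bar> + 1) * (c * N g)"
        using norm_nonneg[OF g] c by (intro mult_right_mono) auto
      ultimately show ?thesis
        using norm_scale[OF g, of "of_real c"] c by (auto simp: mult.assoc)
    qed
    then show "\<exists>K>0. \<forall>f g c. g \<in> B \<longrightarrow> f \<in> borel_measurable lebesgue \<longrightarrow> 0 \<le> c \<longrightarrow>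
        (\<forall>x. norm (f x) \<le> c * norm (g x)) \<longrightarrow> f \<in> B \<and> N f \<le> K * c * N g"
      by (intro exI[of _ "\<bar>C\<bar> + 1"]) auto
  qed
qed

text \<open>
  Translating by \<open>X\<close> and back by \<open>- X\<close> costs a bounded factor each time, since
  \<open>v\<close> is bounded.
\<close>

lemma invariant_BF_space_gaussians_uniform:
  fixes B :: "('a::euclidean_space \<Rightarrow> complex) set"
  assumes "invariant_BF_space B N v" and v: "bounded (range v)"
  shows "gaussians_uniform B N"
  unfolding gaussians_uniform_def
proof (intro allI impI)
  interpret invariant_BF_space B N v by fact
  fix a :: real assume a: "0 < a"
  obtain V where V: "\<And>x. \<bar>v x\<bar> \<le> V"
    using v by (auto simp: bounded_iff)
  obtain C where C: "\<And>f x. f \<in> B \<Longrightarrow> (\<lambda>y. f (y - x)) \<in> B \<and> N (\<lambda>y. f (y - x)) \<le> C * v x * N f"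
    using invariant_solid by blast
  define D where "D = \<bar>C\<bar> * V + 1"
  have translate: "(\<lambda>y. f (y - x)) \<in> B" "N (\<lambda>y. f (y - x)) \<le> D * N f" if f: "f \<in> B" for f x
  proof -
    have "C * v x \<le> \<bar>C\<bar> * V"
      using abs_ge_self[of "C * v x"] mult_left_mono[OF V[of x], of "\<bar>C\<bar>"] by (simp add: abs_mult)
    then have "C * v x * N f \<le> D * N f"
      using norm_nonneg[OF f] by (intro mult_right_mono) (auto simp: D_def)
    with C[OF f, of x] show "(\<lambda>y. f (y - x)) \<in> B" "N (\<lambda>y. f (y - x)) \<le> D * N f"
      by auto
  qed
  have D: "0 < D"
    using V[of undefined] by (auto simp: D_def intro!: add_nonneg_pos mult_nonneg_nonneg)
  let ?g = "gaussian_at a (0 :: 'a)"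
  have g: "?g \<in> B"
    using gaussian_in_GS_space[OF a, where 'a = 'a] GS_subset by (auto simp: gaussian_at_def[abs_def])
  have "\<not> (AE x in lebesgue. ?g x = 0)"
    by (simp add: gaussian_at_def AE_completion_iff eventually_False ae_filter_eq_bot_iff)
  then have pos: "0 < N ?g"
    using norm_eq_0_iff[OF g] norm_nonneg[OF g] by auto
  have "gaussian_at a X \<in> B \<and> N ?g / D \<le> N (gaussian_at a X) \<and> N (gaussian_at a X) \<le> D * N ?g" for X
  proof -
    have 1: "(\<lambda>y. ?g (y - X)) = gaussian_at a X"
      by (simp add: gaussian_at_def[abs_def])
    have 2: "(\<lambda>y. gaussian_at a X (y - (- X))) = ?g"
      by (simp add: gaussian_at_def[abs_def])
    have X: "gaussian_at a X \<in> B"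
      using translate(1)[OF g, of X] unfolding 1 .
    then have "N ?g \<le> D * N (gaussian_at a X)"
      using translate(2)[OF X, of "- X"] unfolding 2 by simp
    with X translate(2)[OF g, of X] D show ?thesis
      unfolding 1 by (simp add: field_simps)
  qed
  then show "\<exists>m>0. \<exists>M. \<forall>X. gaussian_at a X \<in> B \<and> m \<le> N (gaussian_at a X) \<and> N (gaussian_at a X) \<le> M"
    using pos D by (intro exI[of _ "N ?g / D"] conjI exI[of _ "D * N ?g"]) auto
qed

lemma mixed_Lebesgue_exponent_pos:
  fixes p :: "nat \<Rightarrow> ennreal"
  assumes "\<And>i. i < n \<Longrightarrow> 0 < p i"
  shows "0 < enn2real (Min (insert 1 (p ` {..<n})))"
proof -
  have "0 < Min (insert 1 (p ` {..<n}))"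
    using assms by (subst Min_gr_iff) auto
  moreover have "Min (insert 1 (p ` {..<n})) \<le> 1"
    by (rule Min_le) auto
  then have "Min (insert 1 (p ` {..<n})) < \<infinity>"
    by (rule le_less_trans) simp
  ultimately show ?thesis
    by (simp add: enn2real_positive_iff)
qed

lemma mixed_Lebesgue_space_imp_solid:
  fixes B :: "('a::euclidean_space \<Rightarrow> complex) set"
  assumes "mixed_Lebesgue_space B N"
  shows "solid_function_space B N"
proof -
  obtain e p where e: "ordered_basis e" and p: "\<And>i. i < DIM('a) \<Longrightarrow> 0 < p i"
    and B: "B = mixed_Lebesgue e p" and N: "\<And>f. f \<in> B \<Longrightarrow> N f = enn2real (mixed_norm e p f)"
    using assms unfolding mixed_Lebesgue_space_def by blast
  define r where "r = enn2real (Min (insert 1 (p ` {..<DIM('a)})))"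
  have r: "0 < r"
    unfolding r_def using p by (rule mixed_Lebesgue_exponent_pos)
  have mem: "f \<in> B \<longleftrightarrow> f \<in> Lr_loc r \<and> mixed_norm e p f < \<infinity>" for f
    by (simp add: B mixed_Lebesgue_def r_def)
  have meas: "f \<in> borel_measurable lebesgue" if "f \<in> B" for f
    using that by (simp add: mem Lr_loc_def)
  obtain K :: real where K: "0 \<le> K"
    "\<And>f g h c. \<lbrakk>f \<in> borel_measurable lebesgue; g \<in> borel_measurable lebesgue; h \<in> borel_measurable lebesgue;
      0 \<le> c; \<And>z. norm (f z) \<le> c * max (norm (g z)) (norm (h z))\<rbrakk> \<Longrightarrow>
      mixed_norm e p f \<le> ennreal (c * K) * max (mixed_norm e p g) (mixed_norm e p h)"
    using mixed_norm_max_le[of e p, OF e p] by blast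
  have dominated: "f \<in> B" "mixed_norm e p f \<le> ennreal (c * K) * max (mixed_norm e p g) (mixed_norm e p h)"
    if "f \<in> borel_measurable lebesgue" "g \<in> B" "h \<in> B" "0 \<le> c"
      "\<And>z. norm (f z) \<le> c * max (norm (g z)) (norm (h z))" for f g h c
  proof -
    show *: "mixed_norm e p f \<le> ennreal (c * K) * max (mixed_norm e p g) (mixed_norm e p h)"
      by (rule K(2)) (use that meas in auto)
    also have "\<dots> < \<infinity>"
      using that mem by (auto simp: ennreal_mult_less_top max_def)
    finally show "f \<in> B"
      using Lr_loc_dominated[OF r, of g h f c] that mem by auto
  qed
  show ?thesis
  proof
    show "f \<in> borel_measurable lebesgue" if "f \<in> B" for f
      by (rule meas[OF that])
    show "(\<lambda>x. f x - g x) \<in> B" if f: "f \<in> B" and g: "g \<in> B" for f g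
    proof (rule dominated(1)[OF _ f g, of _ 2])
      show "(\<lambda>x. f x - g x) \<in> borel_measurable lebesgue"
        using meas[OF f] meas[OF g] by measurable
      show "norm (f z - g z) \<le> 2 * max (norm (f z)) (norm (g z))" for z
        using norm_triangle_ineq4[of "f z" "g z"] by (simp add: max_def)
    qed simp
    have "f \<in> B \<and> N f \<le> (K + 1) * c * N g"
      if g: "g \<in> B" and f: "f \<in> borel_measurable lebesgue" and c: "0 \<le> c"
        and le: "\<And>x. norm (f x) \<le> c * norm (g x)" for f g c
    proof -
      have fB: "f \<in> B" and bound: "mixed_norm e p f \<le> ennreal (c * K) * mixed_norm e p g"
        using dominated[OF f g g c] le by simp_all
      have "N f \<le> enn2real (ennreal (c * K) * mixed_norm e p g)"
        unfolding N[OF fB] using g bound by (intro enn2real_mono) (auto simp: mem ennreal_mult_less_top)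
      also have "\<dots> = K * c * N g"
        using K(1) c by (simp add: N[OF g] enn2real_mult mult_ac)
      also have "\<dots> \<le> (K + 1) * c * N g"
        using c by (intro mult_right_mono) (auto simp: N[OF g])
      finally show ?thesis
        using fB by simp
    qed
    then show "\<exists>K>0. \<forall>f g c. g \<in> B \<longrightarrow> f \<in> borel_measurable lebesgue \<longrightarrow> 0 \<le> c \<longrightarrow>
        (\<forall>x. norm (f x) \<le> c * norm (g x)) \<longrightarrow> f \<in> B \<and> N f \<le> K * c * N g"
      using K(1) by (intro exI[of _ "K + 1"]) auto
  qed
qed

text \<open>
  The squared Euclidean norm is comparable with the sum of the squares of the coordinates in the basis
  \<open>e\<close>.  The Gaussian therefore lies between two tensor products of one-dimensional Gaussians with
  the same centre, and for these the iterated norm factorizes.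
\<close>

lemma mixed_norm_gaussian:
  fixes e :: "nat \<Rightarrow> 'a::euclidean_space"
  assumes e: "ordered_basis e" and p: "\<And>i. i < DIM('a) \<Longrightarrow> 0 < p i" and a: "0 < a"
  obtains m M :: real where "0 < m"
    "\<And>X. ennreal m \<le> mixed_norm e p (gaussian_at a X)" "\<And>X. mixed_norm e p (gaussian_at a X) \<le> ennreal M"
proof -
  let ?n = "DIM('a)"
  obtain j T where j: "bij_betw j {..<?n} (Basis :: 'a set)" and T: "linear T" "inj T"
    and Te: "\<And>x. T (\<Sum>i<?n. x i *\<^sub>R j i) = (\<Sum>i<?n. x i *\<^sub>R e i)"
    and norm_j: "\<And>x. (norm (\<Sum>i<?n. x i *\<^sub>R j i))\<^sup>2 = (\<Sum>i<?n. (x i)\<^sup>2)"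
    by (rule ordered_basis_coordinates[OF e]) (rule that)
  obtain \<kappa> where \<kappa>: "0 < \<kappa>" "\<And>z. \<kappa> * norm z \<le> norm (T z)"
    using linear_inj_bounded_below_pos[OF T] by blast
  obtain L where L: "0 < L" "\<And>z. norm (T z) \<le> L * norm z"
    using linear_bounded_pos[OF T(1)] by blast
  obtain K :: real where K: "0 \<le> K"
    "\<And>F G H c x. \<lbrakk>F \<in> borel_measurable coordinates; G \<in> borel_measurable coordinates;
      H \<in> borel_measurable coordinates; 0 \<le> c;
      iterated_AE (\<lambda>x. F x \<le> ennreal c * max (G x) (H x)) ?n x\<rbrakk> \<Longrightarrow>
      iterated_norm p F ?n x \<le> ennreal (c * K) * max (iterated_norm p G ?n x) (iterated_norm p H ?n x)"
    using iterated_norm_max_le[of ?n p, OF p] by blast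
  have mono: "iterated_norm p F ?n x \<le> ennreal K * iterated_norm p G ?n x"
    if "F \<in> borel_measurable coordinates" "G \<in> borel_measurable coordinates" "\<And>x. F x \<le> G x" for F G x
    using K(2)[of F G G 1 x] that by (simp add: iterated_AE_I)
  define P where "P = (\<lambda>b \<xi> (x :: nat \<Rightarrow> real). \<Prod>i<?n. ennreal (exp (- (b * (x i - \<xi> i)\<^sup>2))))"
  have P_meas: "P b \<xi> \<in> borel_measurable coordinates" for b \<xi>
    unfolding P_def by measurable
  have P_norm: "\<exists>m>0. \<exists>M. \<forall>\<xi>. ennreal m \<le> iterated_norm p (P b \<xi>) ?n (\<lambda>_. 0) \<and>
      iterated_norm p (P b \<xi>) ?n (\<lambda>_. 0) \<le> ennreal M" if b: "0 < b" for b
  proof -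
    let ?Lp = "\<lambda>i s. Lp_norm (p i) (\<lambda>t. ennreal (exp (- (b * (t - s)\<^sup>2))))"
    have "\<exists>m M. i < ?n \<longrightarrow> 0 < m \<and> (\<forall>s. ennreal m \<le> ?Lp i s \<and> ?Lp i s \<le> ennreal M)" for i
    proof (cases "i < ?n")
      case True
      obtain m M where "0 < m" "\<And>s. ennreal m \<le> ?Lp i s" "\<And>s. ?Lp i s \<le> ennreal M"
        by (rule Lp_norm_gaussian[OF p[OF True] b]) (rule that)
      then show ?thesis
        by blast
    qed simp
    then have "\<forall>i. \<exists>m M. i < ?n \<longrightarrow> 0 < m \<and> (\<forall>s. ennreal m \<le> ?Lp i s \<and> ?Lp i s \<le> ennreal M)" ..
    from this[THEN choice] obtain m where "\<forall>i. \<exists>M. i < ?n \<longrightarrow> 0 < m i \<and> (\<forall>s. ennreal (m i) \<le> ?Lp i s \<and> ?Lp i s \<le> ennreal M)" ..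
    from this[THEN choice] obtain M where
      "\<forall>i. i < ?n \<longrightarrow> 0 < m i \<and> (\<forall>s. ennreal (m i) \<le> ?Lp i s \<and> ?Lp i s \<le> ennreal (M i))" ..
    then have mM: "0 < m i" "ennreal (m i) \<le> ?Lp i s" "?Lp i s \<le> ennreal (M i)" if "i < ?n" for i s
      using that by blast+
    have M: "0 < M i" if "i < ?n" for i
      using order_trans[OF mM(2)[OF that] mM(3)[OF that]] mM(1)[OF that] by (auto simp: ennreal_le_iff2)
    have eq: "iterated_norm p (P b \<xi>) ?n (\<lambda>_. 0) = (\<Prod>i<?n. ?Lp i (\<xi> i))" for \<xi>
      unfolding P_def
      by (subst iterated_norm_prod) (use p le_less_trans[OF mM(3)] in auto)
    have "ennreal (\<Prod>i<?n. m i) \<le> (\<Prod>i<?n. ?Lp i (\<xi> i)) \<and> (\<Prod>i<?n. ?Lp i (\<xi> i)) \<le> ennreal (\<Prod>i<?n. M i)" for \<xi>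
    proof -
      have "ennreal (\<Prod>i<?n. m i) = (\<Prod>i<?n. ennreal (m i))" "ennreal (\<Prod>i<?n. M i) = (\<Prod>i<?n. ennreal (M i))"
        using mM(1) M by (auto intro!: prod_ennreal[symmetric] less_imp_le)
      then show ?thesis
        using mM(2,3) by (auto intro!: prod_mono_ennreal)
    qed
    moreover have "0 < (\<Prod>i<?n. m i)"
      using mM(1) by (intro prod_pos) auto
    ultimately show ?thesis
      unfolding eq by blast
  qed
  obtain m where m: "0 < m" "\<And>\<xi>. ennreal m \<le> iterated_norm p (P (a * L\<^sup>2) \<xi>) ?n (\<lambda>_. 0)"
    using P_norm[of "a * L\<^sup>2"] a L(1) by auto
  obtain M where M: "\<And>\<xi>. iterated_norm p (P (a * \<kappa>\<^sup>2) \<xi>) ?n (\<lambda>_. 0) \<le> ennreal M"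
    using P_norm[of "a * \<kappa>\<^sup>2"] a \<kappa>(1) by auto
  have bounds: "ennreal m \<le> ennreal K * mixed_norm e p (gaussian_at a X)"
    "mixed_norm e p (gaussian_at a X) \<le> ennreal K * ennreal M" for X
  proof -
    obtain z where z: "X = T z"
      using linear_injective_imp_surjective[OF T] by (metis surjD)
    define \<xi> where "\<xi> i = z \<bullet> j i" for i
    have "z = (\<Sum>i<?n. \<xi> i *\<^sub>R j i)"
      using sum.reindex_bij_betw[OF j, of "\<lambda>b. (z \<bullet> b) *\<^sub>R b"] by (simp add: euclidean_representation \<xi>_def)
    then have X: "X = (\<Sum>i<?n. \<xi> i *\<^sub>R e i)"
      using z Te by simp
    have diff: "(\<Sum>i<?n. x i *\<^sub>R e i) - X = T (\<Sum>i<?n. (x i - \<xi> i) *\<^sub>R j i)" for x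
      unfolding X Te by (simp add: sum_subtractf scaleR_diff_left)
    define G where "G = (\<lambda>x. ennreal (norm (gaussian_at a X (\<Sum>i<?n. x i *\<^sub>R e i))))"
    have G_meas: "G \<in> borel_measurable coordinates"
      unfolding G_def
      using measurable_compose[OF measurable_coordinates_sum borel_measurable_continuous_onI[OF continuous_gaussian_at]]
      by measurable
    have P_eq: "P b \<xi> x = ennreal (exp (- (b * (\<Sum>i<?n. (x i - \<xi> i)\<^sup>2))))" for b x
      unfolding P_def by (simp add: prod_ennreal sum_negf sum_distrib_left flip: exp_sum)
    have G_eq: "G x = ennreal (exp (- (a * (norm (T (\<Sum>i<?n. (x i - \<xi> i) *\<^sub>R j i)))\<^sup>2)))" for x
      by (simp add: G_def gaussian_at_def diff)
    have lower: "P (a * L\<^sup>2) \<xi> x \<le> G x" for x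
    proof -
      have "(norm (T (\<Sum>i<?n. (x i - \<xi> i) *\<^sub>R j i)))\<^sup>2 \<le> L\<^sup>2 * (\<Sum>i<?n. (x i - \<xi> i)\<^sup>2)"
        using power_mono[OF L(2)[of "\<Sum>i<?n. (x i - \<xi> i) *\<^sub>R j i"], of 2] by (simp add: power_mult_distrib norm_j)
      from mult_left_mono[OF this, of a] show ?thesis
        unfolding P_eq G_eq using a by (intro ennreal_leI) (simp add: mult.assoc)
    qed
    have upper: "G x \<le> P (a * \<kappa>\<^sup>2) \<xi> x" for x
    proof -
      have "\<kappa>\<^sup>2 * (\<Sum>i<?n. (x i - \<xi> i)\<^sup>2) \<le> (norm (T (\<Sum>i<?n. (x i - \<xi> i) *\<^sub>R j i)))\<^sup>2"
        using power_mono[OF \<kappa>(2)[of "\<Sum>i<?n. (x i - \<xi> i) *\<^sub>R j i"], of 2] \<kappa>(1)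
        by (simp add: power_mult_distrib norm_j)
      from mult_left_mono[OF this, of a] show ?thesis
        unfolding P_eq G_eq using a by (intro ennreal_leI) (simp add: mult.assoc)
    qed
    have eq: "mixed_norm e p (gaussian_at a X) = iterated_norm p G ?n (\<lambda>_. 0)"
      by (simp add: mixed_norm_eq_iterated_norm G_def)
    show "ennreal m \<le> ennreal K * mixed_norm e p (gaussian_at a X)"
      unfolding eq by (rule order_trans[OF m(2) mono[OF P_meas G_meas lower]])
    show "mixed_norm e p (gaussian_at a X) \<le> ennreal K * ennreal M"
      unfolding eq by (rule order_trans[OF mono[OF G_meas P_meas upper]]) (intro mult_left_mono M, simp)
  qed
  \<comment> \<open>If the comparison constant were \<open>0\<close>, the lower bound would force \<open>m = 0\<close>.\<close>
  have "K \<noteq> 0"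
    using bounds(1) m(1) by fastforce
  with K(1) have K_pos: "0 < K"
    by simp
  show ?thesis
  proof (rule that[of "m / K" "K * M"])
    show "0 < m / K"
      using m(1) K_pos by simp
    fix X
    have "ennreal (1 / K) * ennreal m \<le> ennreal (1 / K) * (ennreal K * mixed_norm e p (gaussian_at a X))"
      by (rule mult_left_mono[OF bounds(1)]) simp
    also have "\<dots> = mixed_norm e p (gaussian_at a X)"
      using K_pos by (simp flip: mult.assoc ennreal_mult')
    finally show "ennreal (m / K) \<le> mixed_norm e p (gaussian_at a X)"
      using K_pos by (simp flip: ennreal_mult')
    show "mixed_norm e p (gaussian_at a X) \<le> ennreal (K * M)"
      using bounds(2)[of X] K_pos by (simp add: ennreal_mult')
  qed
qed

lemma mixed_Lebesgue_space_gaussians_uniform: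
  fixes B :: "('a::euclidean_space \<Rightarrow> complex) set"
  assumes "mixed_Lebesgue_space B N"
  shows "gaussians_uniform B N"
  unfolding gaussians_uniform_def
proof (intro allI impI)
  obtain e p where e: "ordered_basis e" and p: "\<And>i. i < DIM('a) \<Longrightarrow> 0 < p i"
    and B: "B = mixed_Lebesgue e p" and N: "\<And>f. f \<in> B \<Longrightarrow> N f = enn2real (mixed_norm e p f)"
    using assms unfolding mixed_Lebesgue_space_def by blast
  fix a :: real assume a: "0 < a"
  obtain m M where m: "0 < m" and bounds: "\<And>X. ennreal m \<le> mixed_norm e p (gaussian_at a X)"
    "\<And>X. mixed_norm e p (gaussian_at a X) \<le> ennreal M"
    using mixed_norm_gaussian[of e p a, OF e p a] by blast
  have "gaussian_at a X \<in> B \<and> m \<le> N (gaussian_at a X) \<and> N (gaussian_at a X) \<le> \<bar>M\<bar>" for X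
  proof -
    have fin: "mixed_norm e p (gaussian_at a X) < \<infinity>"
      using bounds(2) by (rule le_less_trans) simp
    have "norm (gaussian_at a X Y) \<le> 1" for Y
      using a by (simp add: gaussian_at_def)
    then have mem: "gaussian_at a X \<in> B"
      using fin mixed_Lebesgue_exponent_pos[of "DIM('a)" p] p
      by (auto simp: B mixed_Lebesgue_def intro!: bounded_continuous_in_Lr_loc continuous_gaussian_at)
    have "m \<le> enn2real (mixed_norm e p (gaussian_at a X))"
      using enn2real_mono[OF bounds(1)[of X]] fin m by simp
    moreover have "enn2real (mixed_norm e p (gaussian_at a X)) \<le> enn2real (ennreal \<bar>M\<bar>)"
      by (rule enn2real_mono) (auto intro: order_trans[OF bounds(2)] ennreal_leI)
    ultimately show ?thesis
      using mem by (simp add: N[OF mem])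
  qed
  with m show "\<exists>m>0. \<exists>M. \<forall>X. gaussian_at a X \<in> B \<and> m \<le> N (gaussian_at a X) \<and> N (gaussian_at a X) \<le> M"
    by blast
qed

section \<open>The short-time Fourier transform of coherent states\<close>

lemma
  fixes f :: "'d::finite \<Rightarrow> nat \<Rightarrow> complex"
  assumes f: "\<And>i. summable (\<lambda>n. norm (f i n))"
  shows summable_on_prod_multiindex: "(\<lambda>\<alpha>::'d \<Rightarrow> nat. norm (\<Prod>i\<in>UNIV. f i (\<alpha> i))) summable_on UNIV"
    and infsum_prod_multiindex: "(\<Sum>\<^sub>\<infinity>\<alpha>::'d \<Rightarrow> nat. \<Prod>i\<in>UNIV. f i (\<alpha> i)) = (\<Prod>i\<in>UNIV. \<Sum>n. f i n)"
proof -
  have PiE: "PiE (UNIV :: 'd set) (\<lambda>_. UNIV :: nat set) = UNIV"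
    by auto
  have abs: "(\<lambda>n. norm (f i n)) summable_on UNIV" for i
    using f[of i] by (simp add: summable_on_UNIV_nonneg_real_iff)
  then have "Infinite_Set_Sum.abs_summable_on (f i) UNIV" for i
    by (simp add: abs_summable_equivalent)
  then have "Infinite_Set_Sum.abs_summable_on (\<lambda>\<alpha>::'d \<Rightarrow> nat. \<Prod>i\<in>UNIV. f i (\<alpha> i)) (PiE UNIV (\<lambda>_. UNIV))"
    by (intro abs_summable_on_prod_PiE) auto
  then show "(\<lambda>\<alpha>::'d \<Rightarrow> nat. norm (\<Prod>i\<in>UNIV. f i (\<alpha> i))) summable_on UNIV"
    unfolding PiE by (simp add: abs_summable_equivalent)
  have "(\<Sum>\<^sub>\<infinity>\<alpha>\<in>PiE UNIV (\<lambda>_. UNIV). \<Prod>i\<in>UNIV. f i (\<alpha> i)) = (\<Prod>i\<in>UNIV. infsum (f i) UNIV)"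
    by (intro infsum_prod_PiE_abs abs) auto
  moreover have "infsum (f i) UNIV = (\<Sum>n. f i n)" for i
    using norm_summable_imp_has_sum[OF f summable_sums[OF summable_norm_cancel[OF f]]] by (rule infsumI)
  ultimately show "(\<Sum>\<^sub>\<infinity>\<alpha>::'d \<Rightarrow> nat. \<Prod>i\<in>UNIV. f i (\<alpha> i)) = (\<Prod>i\<in>UNIV. \<Sum>n. f i n)"
    unfolding PiE by simp
qed

text \<open>
  The condition on the coefficients holds for every \<open>r > 0\<close>; the choice \<open>r \<le> 1 / (2
  |z\<^sub>i|)\<close> for all \<open>i\<close> gives a geometric majorant with ratio \<open>1 / 2\<close>.
\<close>

lemma Bargmann_summable:
  fixes z :: "complex ^ 'd::finite"
  assumes c: "c \<in> H_flat'"
  shows "(\<lambda>\<alpha>. c \<alpha> * (\<Prod>i\<in>UNIV. (z $ i) ^ \<alpha> i) / of_real (sqrt (\<Prod>i\<in>UNIV. fact (\<alpha> i)))) summable_on UNIV"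
proof -
  define r where "r = 1 / (2 * (1 + norm z))"
  have r: "0 < r"
    by (simp add: r_def add_pos_nonneg)
  have rz: "r * norm (z $ i) \<le> 1 / 2" for i
    using Finite_Cartesian_Product.norm_nth_le[of z i] norm_ge_zero[of z]
    by (simp add: r_def field_simps add_pos_nonneg del: norm_ge_zero)
  obtain C where C: "\<And>\<alpha>. norm (c \<alpha>) \<le> C * (r ^ (\<Sum>i\<in>UNIV. \<alpha> i) * sqrt (\<Prod>i\<in>UNIV. fact (\<alpha> i)))"
    using c r unfolding H_flat'_def by blast
  have C0: "0 \<le> C"
    using order_trans[OF norm_ge_zero C[of "\<lambda>_. 0"]] by simp
  have "(\<lambda>\<alpha>::'d \<Rightarrow> nat. norm (\<Prod>i\<in>UNIV. (1 / 2 :: complex) ^ \<alpha> i)) summable_on UNIV"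
    by (rule summable_on_prod_multiindex) (simp add: norm_power norm_divide summable_geometric)
  then have "(\<lambda>\<alpha>::'d \<Rightarrow> nat. C * (\<Prod>i\<in>UNIV. (1 / 2) ^ \<alpha> i)) summable_on UNIV"
    by (intro summable_on_cmult_right) (simp add: norm_power norm_divide flip: prod_norm)
  then have "(\<lambda>\<alpha>. norm (c \<alpha> * (\<Prod>i\<in>UNIV. (z $ i) ^ \<alpha> i) / of_real (sqrt (\<Prod>i\<in>UNIV. fact (\<alpha> i))))) summable_on UNIV"
  proof (rule summable_on_comparison_test)
    fix \<alpha> :: "'d \<Rightarrow> nat"
    define s where "s = sqrt (\<Prod>i\<in>UNIV. fact (\<alpha> i))"
    have s: "0 < s"
      by (simp add: s_def prod_pos)
    have "norm (c \<alpha> * (\<Prod>i\<in>UNIV. (z $ i) ^ \<alpha> i) / of_real s) = norm (c \<alpha>) * (\<Prod>i\<in>UNIV. norm (z $ i) ^ \<alpha> i) / s"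
      using s by (simp add: norm_mult norm_divide norm_power flip: prod_norm)
    also have "\<dots> \<le> C * (r ^ (\<Sum>i\<in>UNIV. \<alpha> i) * s) * (\<Prod>i\<in>UNIV. norm (z $ i) ^ \<alpha> i) / s"
      using C[of \<alpha>] s by (intro divide_right_mono mult_right_mono prod_nonneg) (auto simp: s_def)
    also have "\<dots> = C * (\<Prod>i\<in>UNIV. (r * norm (z $ i)) ^ \<alpha> i)"
      using s by (simp add: power_mult_distrib prod.distrib power_sum)
    also have "\<dots> \<le> C * (\<Prod>i\<in>UNIV. (1 / 2) ^ \<alpha> i)"
      using C0 r rz by (intro mult_left_mono prod_mono conjI power_mono) auto
    finally show "norm (c \<alpha> * (\<Prod>i\<in>UNIV. (z $ i) ^ \<alpha> i) / of_real (sqrt (\<Prod>i\<in>UNIV. fact (\<alpha> i)))) \<le> C * (\<Prod>i\<in>UNIV. (1 / 2) ^ \<alpha> i)"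
      by (simp add: s_def)
  qed simp
  then show ?thesis
    by (rule abs_summable_summable)
qed

lemma STFT_diff:
  assumes "f \<in> H_flat'" "g \<in> H_flat'"
  shows "STFT (g - f) X = STFT g X - STFT f X"
proof -
  have "Bargmann (g - f) z = Bargmann g z - Bargmann f z" for z
    unfolding Bargmann_def
    using has_sum_add[OF has_sum_infsum[OF Bargmann_summable[OF assms(2), of z]]
        has_sum_uminusI[OF has_sum_infsum[OF Bargmann_summable[OF assms(1), of z]]]]
    by (intro infsumI) (simp add: left_diff_distrib diff_divide_distrib)
  then show ?thesis
    by (simp add: STFT_def Let_def split_beta right_diff_distrib)
qed

lemma H_flat'_diff:
  assumes "f \<in> H_flat'" "g \<in> H_flat'"
  shows "g - f \<in> H_flat'"
  unfolding H_flat'_def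
proof (intro CollectI allI impI)
  fix r :: real assume "0 < r"
  then obtain C D where
    "\<And>\<alpha>. norm (f \<alpha>) \<le> C * (r ^ (\<Sum>i\<in>UNIV. \<alpha> i) * sqrt (\<Prod>i\<in>UNIV. fact (\<alpha> i)))"
    "\<And>\<alpha>. norm (g \<alpha>) \<le> D * (r ^ (\<Sum>i\<in>UNIV. \<alpha> i) * sqrt (\<Prod>i\<in>UNIV. fact (\<alpha> i)))"
    using assms unfolding H_flat'_def by blast
  then have "norm ((g - f) \<alpha>) \<le> (D + C) * (r ^ (\<Sum>i\<in>UNIV. \<alpha> i) * sqrt (\<Prod>i\<in>UNIV. fact (\<alpha> i)))" for \<alpha>
    unfolding distrib_right minus_apply by (intro order_trans[OF norm_triangle_ineq4 add_mono])
  then show "\<exists>C. \<forall>\<alpha>. norm ((g - f) \<alpha>) \<le> C * (r ^ (\<Sum>i\<in>UNIV. \<alpha> i) * sqrt (\<Prod>i\<in>UNIV. fact (\<alpha> i)))"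
    by blast
qed

text \<open>
  The point of \<open>\<complex>\<^sup>d\<close> at which the Bargmann transform determines the short-time
  Fourier transform at \<open>X\<close>.
\<close>

definition phase_point :: "(real ^ 'd::finite) \<times> (real ^ 'd) \<Rightarrow> complex ^ 'd" where
  "phase_point X = (\<chi> j. Complex (((1 / sqrt 2) *\<^sub>R fst X) $ j) ((- (1 / sqrt 2) *\<^sub>R snd X) $ j))"

text \<open>
  A multiple of the time-frequency shift of the window to the phase space point \<open>X\<close>: its Bargmann
  transform is a multiple of \<open>z \<mapsto> exp (\<Sum>\<^sub>i z\<^sub>i cnj w\<^sub>i)\<close>, where
  \<open>w\<close> is the phase point of \<open>X\<close>.  The factor is chosen so that \<open>t\<close> is the
  maximum of the modulus of the short-time Fourier transform.
\<close>

definition coherent :: "real \<Rightarrow> (real ^ 'd::finite) \<times> (real ^ 'd) \<Rightarrow> 'd hermite_expansion" where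
  "coherent t X \<alpha> = of_real (t * (2 * pi) powr (real CARD('d) / 2) * exp (- ((norm X)\<^sup>2 / 4))) *
     (\<Prod>i\<in>UNIV. cnj (phase_point X $ i) ^ \<alpha> i) / of_real (sqrt (\<Prod>i\<in>UNIV. fact (\<alpha> i)))"

lemma coherent_in_H_flat': "coherent t X \<in> H_flat'"
  unfolding H_flat'_def
proof (intro CollectI allI impI)
  fix r :: real assume r: "0 < r"
  define w where "w = phase_point X"
  define A where "A = t * (2 * pi) powr (real CARD('a) / 2) * exp (- ((norm X)\<^sup>2 / 4))"
  have "norm (coherent t X \<alpha>) \<le> (\<bar>A\<bar> * (\<Prod>i\<in>UNIV. exp (norm (w $ i) / r))) *
      (r ^ (\<Sum>i\<in>UNIV. \<alpha> i) * sqrt (\<Prod>i\<in>UNIV. fact (\<alpha> i)))" for \<alpha>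
  proof -
    define s where "s = sqrt (\<Prod>i\<in>UNIV. fact (\<alpha> i) :: real)"
    have s: "0 < s" "s * s = (\<Prod>i\<in>UNIV. fact (\<alpha> i))"
      by (simp_all add: s_def prod_pos prod_nonneg)
    have "norm (w $ i) ^ \<alpha> i \<le> exp (norm (w $ i) / r) * r ^ \<alpha> i * fact (\<alpha> i)" for i
      using power_le_fact_exp[of "norm (w $ i) / r" "\<alpha> i"] r by (simp add: power_divide field_simps)
    then have "(\<Prod>i\<in>UNIV. norm (w $ i) ^ \<alpha> i) \<le> (\<Prod>i\<in>UNIV. exp (norm (w $ i) / r) * r ^ \<alpha> i * fact (\<alpha> i))"
      by (intro prod_mono) auto
    also have "\<dots> = (\<Prod>i\<in>UNIV. exp (norm (w $ i) / r)) * r ^ (\<Sum>i\<in>UNIV. \<alpha> i) * (s * s)"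
      by (simp add: prod.distrib power_sum s(2))
    finally have "\<bar>A\<bar> * (\<Prod>i\<in>UNIV. norm (w $ i) ^ \<alpha> i) \<le> \<bar>A\<bar> * \<dots>"
      by (rule mult_left_mono) simp
    moreover have "norm (coherent t X \<alpha>) = \<bar>A\<bar> * (\<Prod>i\<in>UNIV. norm (w $ i) ^ \<alpha> i) / s"
      unfolding coherent_def A_def[symmetric] w_def[symmetric] s_def[symmetric]
      using s(1) by (simp add: norm_mult norm_divide norm_power flip: prod_norm)
    ultimately show ?thesis
      using s(1) by (simp add: divide_le_eq mult_ac flip: s_def)
  qed
  then show "\<exists>C. \<forall>\<alpha>. norm (coherent t X \<alpha>) \<le> C * (r ^ (\<Sum>i\<in>UNIV. \<alpha> i) * sqrt (\<Prod>i\<in>UNIV. fact (\<alpha> i)))"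
    by blast
qed

lemma Bargmann_coherent:
  fixes X :: "(real ^ 'd::finite) \<times> (real ^ 'd)"
  shows "Bargmann (coherent t X) z =
    of_real (t * (2 * pi) powr (real CARD('d) / 2) * exp (- ((norm X)\<^sup>2 / 4))) *
    exp (\<Sum>i\<in>UNIV. z $ i * cnj (phase_point X $ i))"
proof -
  define A where "A = t * (2 * pi) powr (real CARD('d) / 2) * exp (- ((norm X)\<^sup>2 / 4))"
  let ?w = "\<lambda>i. z $ i * cnj (phase_point X $ i)"
  have "coherent t X \<alpha> * (\<Prod>i\<in>UNIV. (z $ i) ^ \<alpha> i) / of_real (sqrt (\<Prod>i\<in>UNIV. fact (\<alpha> i))) =
      of_real A * (\<Prod>i\<in>UNIV. ?w i ^ \<alpha> i /\<^sub>R fact (\<alpha> i))" for \<alpha>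
  proof -
    define s where "s = sqrt (\<Prod>i\<in>UNIV. fact (\<alpha> i) :: real)"
    have 1: "of_real s * of_real s = (\<Prod>i\<in>UNIV. fact (\<alpha> i) :: complex)"
      by (simp add: s_def prod_nonneg flip: of_real_mult)
    have 2: "(\<Prod>i\<in>UNIV. ?w i ^ \<alpha> i /\<^sub>R fact (\<alpha> i)) =
        (\<Prod>i\<in>UNIV. cnj (phase_point X $ i) ^ \<alpha> i) * (\<Prod>i\<in>UNIV. (z $ i) ^ \<alpha> i) / (\<Prod>i\<in>UNIV. fact (\<alpha> i))"
    proof -
      have "(\<Prod>i\<in>UNIV. ?w i ^ \<alpha> i /\<^sub>R fact (\<alpha> i)) =
          (\<Prod>i\<in>UNIV. cnj (phase_point X $ i) ^ \<alpha> i * (z $ i) ^ \<alpha> i / fact (\<alpha> i))"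
        by (intro prod.cong) (simp_all add: scaleR_conv_of_real power_mult_distrib divide_inverse mult_ac)
      then show ?thesis
        by (simp add: prod.distrib prod_dividef)
    qed
    show ?thesis
      unfolding 2 1[symmetric] coherent_def A_def[symmetric] s_def[symmetric] by simp
  qed
  then have "Bargmann (coherent t X) z = (\<Sum>\<^sub>\<infinity>\<alpha>. of_real A * (\<Prod>i\<in>UNIV. ?w i ^ \<alpha> i /\<^sub>R fact (\<alpha> i)))"
    unfolding Bargmann_def by (intro infsum_cong) auto
  also have "\<dots> = of_real A * (\<Sum>\<^sub>\<infinity>\<alpha>. \<Prod>i\<in>UNIV. ?w i ^ \<alpha> i /\<^sub>R fact (\<alpha> i))"
    by (rule infsum_cmult_right')
  also have "(\<Sum>\<^sub>\<infinity>\<alpha>. \<Prod>i\<in>UNIV. ?w i ^ \<alpha> i /\<^sub>R fact (\<alpha> i)) = (\<Prod>i\<in>UNIV. \<Sum>n. ?w i ^ n /\<^sub>R fact n)"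
    by (rule infsum_prod_multiindex) (rule summable_norm_exp)
  also have "\<dots> = (\<Prod>i\<in>UNIV. exp (?w i))"
    by (simp add: exp_def)
  also have "\<dots> = exp (\<Sum>i\<in>UNIV. ?w i)"
    by (simp add: exp_sum)
  finally show ?thesis
    by (simp add: A_def)
qed

text \<open>
  The exponents combine by polarization: with \<open>w\<close> the phase point of \<open>X\<close> and
  \<open>z\<close> that of \<open>Y\<close>, \<open>- |z|\<^sup>2 / 2 + Re (z \<sqdot> cnj w) - |w|\<^sup>2 / 2
  = - |z - w|\<^sup>2 / 2\<close>, and \<open>|z - w|\<^sup>2 = |Y - X|\<^sup>2 / 2\<close>.
\<close>

lemma norm_STFT_coherent:
  assumes t: "0 \<le> t"
  shows "norm (STFT (coherent t X) Y) = t * exp (- ((norm (Y - X))\<^sup>2 / 4))"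
proof -
  obtain y \<eta> where Y: "Y = (y, \<eta>)" by force
  obtain y' \<eta>' where X: "X = (y', \<eta>')" by force
  have Re: "Re (\<Sum>i\<in>UNIV. phase_point Y $ i * cnj (phase_point X $ i)) = (y \<bullet> y' + \<eta> \<bullet> \<eta>') / 2"
  proof -
    have "Re (\<Sum>i\<in>UNIV. phase_point Y $ i * cnj (phase_point X $ i)) =
        (\<Sum>i\<in>UNIV. (y $ i * y' $ i + \<eta> $ i * \<eta>' $ i) / 2)"
      by (simp add: phase_point_def X Y field_simps)
    then show ?thesis
      by (simp add: inner_vec_def sum.distrib flip: sum_divide_distrib)
  qed
  have point: "(\<chi> j. Complex (((1 / sqrt 2) *\<^sub>R y) $ j) ((- (1 / sqrt 2) *\<^sub>R \<eta>) $ j)) = phase_point Y"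
    by (simp add: phase_point_def Y)
  have "norm (STFT (coherent t X) Y) = t *
      ((2 * pi) powr (- real CARD('a) / 2) * (2 * pi) powr (real CARD('a) / 2)) *
      (exp (- ((norm ((1 / sqrt 2) *\<^sub>R y))\<^sup>2 + (norm (- (1 / sqrt 2) *\<^sub>R \<eta>))\<^sup>2) / 2) *
       exp (- ((norm X)\<^sup>2 / 4)) * exp ((y \<bullet> y' + \<eta> \<bullet> \<eta>') / 2))"
    unfolding Y STFT_def prod.case Let_def Bargmann_coherent point[unfolded Y]
    using t by (simp only: norm_mult norm_exp_eq_Re Re[unfolded Y] norm_of_real) (simp add: mult_ac)
  also have "(2 * pi) powr (- real CARD('a) / 2) * (2 * pi) powr (real CARD('a) / 2) = 1"
    by (simp flip: powr_add)
  also have "exp (- ((norm ((1 / sqrt 2) *\<^sub>R y))\<^sup>2 + (norm (- (1 / sqrt 2) *\<^sub>R \<eta>))\<^sup>2) / 2) *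
       exp (- ((norm X)\<^sup>2 / 4)) * exp ((y \<bullet> y' + \<eta> \<bullet> \<eta>') / 2) = exp (- ((norm (Y - X))\<^sup>2 / 4))"
    unfolding X Y exp_add[symmetric]
    by (intro arg_cong[where f = exp])
      (simp add: power2_norm_eq_inner inner_diff_left inner_diff_right inner_commute power_mult_distrib power_divide field_simps)
  finally show ?thesis
    by simp
qed

lemma continuous_STFT_coherent: "continuous_on UNIV (STFT (coherent t X))"
  unfolding STFT_def Let_def split_beta Bargmann_coherent
  by (auto simp: Complex_eq intro!: continuous_intros)

section \<open>Moderate weights\<close>

text \<open>
  The weight \<open>v\<close> in the definition of moderateness is bounded only almost everywhere on compact
  sets.  Every \<open>y\<close> in the unit ball is nevertheless a sum of two points \<open>a\<close> and
  \<open>y - a\<close> at which \<open>v\<close> is bounded, since the bad points \<open>a\<close> form a null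
  set.  So shifts of length at most \<open>1\<close> change \<open>\<omega>\<close> by at most a constant factor
  \<open>K\<close>, and a shift by \<open>y\<close> is a composition of \<open>\<lceil>|y|\<rceil>\<close> such
  shifts.
\<close>

lemma moderate_weight_exp:
  fixes \<omega> :: "'a::euclidean_space \<Rightarrow> real"
  assumes "moderate_weight \<omega>"
  obtains C r :: real where "0 < C" "0 \<le> r" "\<And>x y. \<omega> (x + y) \<le> C * exp (r * norm y) * \<omega> x"
proof -
  obtain v c where v: "weight v" and c: "0 < c" and mod: "\<And>x y. \<omega> (x + y) \<le> c * (\<omega> x * v y)"
    using assms by (auto simp: moderate_weight_def)
  have pos: "0 < \<omega> x" "0 < v x" for x
    using assms v by (auto simp: moderate_weight_def weight_def)
  obtain V where V: "AE x in lebesgue. x \<in> cball 0 1 \<longrightarrow> \<bar>v x\<bar> \<le> V"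
    using v compact_cball unfolding weight_def Linf_loc_def by blast
  obtain S where S_AE: "\<And>x. x \<in> space lebesgue - S \<Longrightarrow> x \<in> cball 0 1 \<longrightarrow> \<bar>v x\<bar> \<le> V" and "S \<in> null_sets lebesgue"
    by (rule AE_E3[OF V]) (rule that)
  then have S: "v x \<le> V" if "x \<notin> S" "norm x \<le> 1" for x
    using S_AE[of x] that by (simp add: abs_le_iff)
  have S_negl: "negligible S"
    using \<open>S \<in> null_sets lebesgue\<close> by (simp add: negligible_iff_null_sets)
  define K where "K = max 1 ((c * V)\<^sup>2)"
  have step: "\<omega> (x + y) \<le> K * \<omega> x" if y: "norm y \<le> 1" for x y
  proof -
    have "negligible ((\<lambda>a. y - a) ` S)"
      by (rule negligible_differentiable_image_negligible)
        (auto simp: S_negl differentiable_on_def intro!: differentiable_diff)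
    then have "negligible (S \<union> (\<lambda>a. y - a) ` S)"
      by (rule negligible_Un[OF S_negl])
    moreover have "\<not> negligible (ball ((1 / 2) *\<^sub>R y) (1 / 2))"
      by (rule open_not_negligible) auto
    ultimately have "\<not> ball ((1 / 2) *\<^sub>R y) (1 / 2) \<subseteq> S \<union> (\<lambda>a. y - a) ` S"
      using negligible_subset by blast
    then obtain a where a: "a \<in> ball ((1 / 2) *\<^sub>R y) (1 / 2)" "a \<notin> S" "a \<notin> (\<lambda>a. y - a) ` S"
      by blast
    have "y - a \<notin> S"
    proof
      assume "y - a \<in> S"
      from imageI[OF this, of "\<lambda>a. y - a"] a(3) show False
        by simp
    qed
    have half: "norm (a - (1 / 2) *\<^sub>R y) \<le> 1 / 2" "norm ((1 / 2) *\<^sub>R y) \<le> 1 / 2"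
      using a(1) y by (auto simp: dist_norm norm_minus_commute)
    have "norm a \<le> 1"
      using norm_triangle_ineq[of "a - (1 / 2) *\<^sub>R y" "(1 / 2) *\<^sub>R y"] half by simp
    moreover have "norm (y - a) \<le> 1"
    proof -
      have "(1 / 2) *\<^sub>R y - (a - (1 / 2) *\<^sub>R y) = y - a"
        by (simp add: algebra_simps flip: scaleR_add_left)
      then have "norm (y - a) = norm ((1 / 2) *\<^sub>R y - (a - (1 / 2) *\<^sub>R y))"
        by (rule arg_cong[OF sym])
      then show ?thesis
        using norm_triangle_ineq4[of "(1 / 2) *\<^sub>R y" "a - (1 / 2) *\<^sub>R y"] half by simp
    qed
    ultimately have vV: "v a \<le> V" "v (y - a) \<le> V"
      using S a(2) \<open>y - a \<notin> S\<close> by auto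
    have V0: "0 \<le> V"
      using pos(2)[of a] vV by simp
    have "\<omega> (x + y) \<le> c * (\<omega> (x + a) * v (y - a))"
      using mod[of "x + a" "y - a"] by simp
    also have "\<dots> \<le> c * (c * (\<omega> x * V) * V)"
      using vV c V0 pos less_imp_le[OF pos(1)] less_imp_le[OF pos(2)]
      by (intro mult_left_mono mult_mono order_trans[OF mod[of x a]]) auto
    also have "\<dots> = (c * V)\<^sup>2 * \<omega> x"
      by (simp add: power2_eq_square)
    also have "\<dots> \<le> K * \<omega> x"
      using pos(1)[of x] by (intro mult_right_mono) (auto simp: K_def)
    finally show ?thesis .
  qed
  have K: "1 \<le> K"
    by (simp add: K_def)
  have iterate: "norm y \<le> real n \<Longrightarrow> \<omega> (x + y) \<le> K ^ n * \<omega> x" for n x y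
  proof (induction n arbitrary: y)
    case (Suc n)
    \<comment> \<open>One step of length at most \<open>1\<close> remains after going to \<open>n / (n + 1)\<close> of \<open>y\<close>.\<close>
    define y' where "y' = (real n / real (Suc n)) *\<^sub>R y"
    have diff: "y - y' = (1 / real (Suc n)) *\<^sub>R y"
    proof -
      have "y - y' = (1 - real n / real (Suc n)) *\<^sub>R y"
        by (simp add: y'_def scaleR_diff_left)
      also have "1 - real n / real (Suc n) = 1 / real (Suc n)"
        by (simp add: field_simps)
      finally show ?thesis .
    qed
    have "norm y' \<le> real n"
      using mult_left_mono[OF Suc.prems, of "real n / real (Suc n)"] by (simp add: y'_def)
    then have "\<omega> (x + y') \<le> K ^ n * \<omega> x"
      by (rule Suc.IH)
    moreover have "norm (y - y') \<le> 1"
      unfolding diff using Suc.prems by (simp add: field_simps)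
    then have "\<omega> (x + y' + (y - y')) \<le> K * \<omega> (x + y')"
      by (rule step)
    ultimately have "\<omega> (x + y' + (y - y')) \<le> K * (K ^ n * \<omega> x)"
      using K by (meson mult_left_mono order_trans zero_le_one)
    then show ?case
      by (simp add: mult.assoc)
  qed simp
  show ?thesis
  proof (rule that[of K "ln K"])
    fix x y :: 'a
    define n where "n = nat \<lceil>norm y\<rceil>"
    have n: "norm y \<le> real n" "real n \<le> norm y + 1"
      by (simp_all add: n_def real_nat_ceiling_ge)
    have "K ^ n = exp (ln K * real n)"
      using K by (simp add: exp_of_nat2_mult)
    also have "\<dots> \<le> exp (ln K * (norm y + 1))"
      using K n(2) by (simp add: mult_left_mono)
    also have "\<dots> = K * exp (ln K * norm y)"
      using K by (simp add: distrib_left exp_add)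
    finally have "K ^ n * \<omega> x \<le> K * exp (ln K * norm y) * \<omega> x"
      using pos(1)[of x] by (intro mult_right_mono) auto
    with iterate[OF n(1), of x] show "\<omega> (x + y) \<le> K * exp (ln K * norm y) * \<omega> x"
      by linarith
  qed (use K in auto)
qed

lemma weight_measurable: "weight \<omega> \<Longrightarrow> \<omega> \<in> borel_measurable lebesgue"
  by (simp add: weight_def Linf_loc_def)

section \<open>The embedding of modulation spaces\<close>

lemma modulation_embedding_continuousI:
  fixes \<omega>1 \<omega>2 :: "(real ^ 'd::finite) \<times> (real ^ 'd) \<Rightarrow> real"
  assumes "solid_function_space B N" and w1: "weight \<omega>1" and w2: "weight \<omega>2"
    and le: "\<And>X. \<omega>2 X / \<omega>1 X \<le> C"
  shows "modulation_embedding_continuous \<omega>1 \<omega>2 B N"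
proof -
  interpret solid_function_space B N by fact
  have pos: "0 < \<omega>1 X" "0 < \<omega>2 X" for X
    using w1 w2 unfolding weight_def by blast+
  have C: "0 < C"
    using less_le_trans[OF divide_pos_pos[OF pos(2)[of undefined] pos(1)[of undefined]] le] .
  obtain K where K: "0 < K" and solidK: "\<And>f g c. g \<in> B \<Longrightarrow> f \<in> borel_measurable lebesgue \<Longrightarrow> 0 \<le> c \<Longrightarrow>
      (\<And>x. norm (f x) \<le> c * norm (g x)) \<Longrightarrow> f \<in> B \<and> N f \<le> K * c * N g"
    using solid by blast
  have bound: "f \<in> modulation_space \<omega>2 B \<and> modulation_norm \<omega>2 N f \<le> K * C * modulation_norm \<omega>1 N f"
    if f: "f \<in> modulation_space \<omega>1 B" for f :: "'d hermite_expansion"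
  proof -
    let ?F = "\<lambda>\<omega> X. STFT f X * of_real (\<omega> X)"
    have F1: "?F \<omega>1 \<in> B"
      using f by (simp add: modulation_space_def)
    have "(\<lambda>X. ?F \<omega>1 X * of_real (\<omega>2 X / \<omega>1 X)) \<in> borel_measurable lebesgue"
      using mem_measurable[OF F1] weight_measurable[OF w1] weight_measurable[OF w2] by measurable
    also have "(\<lambda>X. ?F \<omega>1 X * of_real (\<omega>2 X / \<omega>1 X)) = ?F \<omega>2"
      using pos(1) by (auto simp: fun_eq_iff less_imp_neq[THEN not_sym])
    finally have meas: "?F \<omega>2 \<in> borel_measurable lebesgue" .
    have "norm (?F \<omega>2 X) \<le> C * norm (?F \<omega>1 X)" for X
    proof -
      have "\<omega>2 X \<le> C * \<omega>1 X"
        using le[of X] pos(1)[of X] by (simp add: divide_le_eq)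
      from mult_left_mono[OF this norm_ge_zero[of "STFT f X"]] show ?thesis
        using pos[of X] by (simp add: norm_mult mult_ac)
    qed
    then have "?F \<omega>2 \<in> B \<and> N (?F \<omega>2) \<le> K * C * N (?F \<omega>1)"
      by (intro solidK[OF F1 meas]) (use C in auto)
    with f show ?thesis
      by (simp add: modulation_space_def modulation_norm_def)
  qed
  have diff: "g - f \<in> modulation_space \<omega>1 B"
    if "f \<in> modulation_space \<omega>1 B" "g \<in> modulation_space \<omega>1 B" for f g :: "'d hermite_expansion"
    using that diff_mem[of "\<lambda>X. STFT g X * of_real (\<omega>1 X)" "\<lambda>X. STFT f X * of_real (\<omega>1 X)"]
    by (auto simp: modulation_space_def H_flat'_diff STFT_diff left_diff_distrib)
  show ?thesis
    unfolding modulation_embedding_continuous_def quasinorm_continuous_def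
  proof (intro conjI ballI allI impI)
    show "(\<lambda>f. f) ` modulation_space \<omega>1 B \<subseteq> modulation_space \<omega>2 B"
      using bound by auto
    fix f :: "'d hermite_expansion" and \<epsilon> :: real
    assume f: "f \<in> modulation_space \<omega>1 B" and \<epsilon>: "0 < \<epsilon>"
    show "\<exists>\<delta>>0. \<forall>g\<in>modulation_space \<omega>1 B. modulation_norm \<omega>1 N (g - f) < \<delta> \<longrightarrow> modulation_norm \<omega>2 N (g - f) < \<epsilon>"
    proof (intro exI[of _ "\<epsilon> / (K * C)"] conjI ballI impI)
      show "0 < \<epsilon> / (K * C)"
        using \<epsilon> K C by simp
      fix g assume g: "g \<in> modulation_space \<omega>1 B" and "modulation_norm \<omega>1 N (g - f) < \<epsilon> / (K * C)"
      then have "K * C * modulation_norm \<omega>1 N (g - f) < \<epsilon>"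
        using K C by (simp add: field_simps)
      with bound[OF diff[OF f g]] show "modulation_norm \<omega>2 N (g - f) < \<epsilon>"
        by linarith
    qed
  qed
qed

text \<open>
  By solidity, the coherent state of size \<open>t\<close> at \<open>X\<close> has first norm at most a constant
  times \<open>t * \<omega>1 X\<close>, and second norm at least a positive constant times \<open>t * \<omega>2
  X\<close>.  Choosing \<open>t\<close> of order \<open>1 / \<omega>1 X\<close> makes the first norm smaller
  than the \<open>\<delta>\<close> of continuity at \<open>0\<close>, so that the second stays below
  \<open>1\<close>.
\<close>

lemma weight_ratio_bounded:
  fixes \<omega>1 \<omega>2 :: "(real ^ 'd::finite) \<times> (real ^ 'd) \<Rightarrow> real"
  assumes "solid_function_space B N" and gauss: "gaussians_uniform B N"
    and mod: "moderate_weight \<omega>1" "moderate_weight \<omega>2"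
    and cont: "modulation_embedding_continuous \<omega>1 \<omega>2 B N"
  shows "\<exists>C>0. \<forall>X. \<omega>2 X / \<omega>1 X \<le> C"
proof -
  interpret solid_function_space B N by fact
  have pos: "0 < \<omega>1 X" "0 < \<omega>2 X" for X
    using mod unfolding moderate_weight_def weight_def by blast+
  have meas: "\<omega>1 \<in> borel_measurable lebesgue" "\<omega>2 \<in> borel_measurable lebesgue"
    using mod by (auto simp: moderate_weight_def intro: weight_measurable)
  obtain K where K: "0 < K" and solidK: "\<And>f g c. g \<in> B \<Longrightarrow> f \<in> borel_measurable lebesgue \<Longrightarrow> 0 \<le> c \<Longrightarrow>
      (\<And>x. norm (f x) \<le> c * norm (g x)) \<Longrightarrow> f \<in> B \<and> N f \<le> K * c * N g"
    using solid by blast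
  obtain M where M: "\<And>X. gaussian_at (1 / 8) X \<in> B" "\<And>X. N (gaussian_at (1 / 8) X) \<le> M"
    using gauss[unfolded gaussians_uniform_def, rule_format, of "1 / 8"] by auto
  obtain m where m: "0 < m" "\<And>X. m \<le> N (gaussian_at (1 / 2) X)"
    using gauss[unfolded gaussians_uniform_def, rule_format, of "1 / 2"] by auto
  obtain C1 r1 where C1: "0 < C1" "0 \<le> r1" "\<And>X Y. \<omega>1 (X + Y) \<le> C1 * exp (r1 * norm Y) * \<omega>1 X"
    using moderate_weight_exp[OF mod(1)] by blast
  obtain C2 r2 where C2: "0 < C2" "0 \<le> r2" "\<And>X Y. \<omega>2 (X + Y) \<le> C2 * exp (r2 * norm Y) * \<omega>2 X"
    using moderate_weight_exp[OF mod(2)] by blast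
  define D1 where "D1 = C1 * exp (2 * r1\<^sup>2)"
  define D2 where "D2 = C2 * exp (r2\<^sup>2)"
  have D: "0 < D1" "0 < D2"
    using C1 C2 by (simp_all add: D1_def D2_def)
  have gauss_norm: "norm (gaussian_at a X Y) = exp (- (a * (norm (Y - X))\<^sup>2))" for a and X Y :: "(real ^ 'd) \<times> (real ^ 'd)"
    by (simp add: gaussian_at_def)
  let ?F = "\<lambda>\<omega> t X Y. STFT (coherent t X) Y * of_real (\<omega> Y)"
  have F_meas: "?F \<omega>1 t X \<in> borel_measurable lebesgue" for t X
    using measurable_completion[OF borel_measurable_continuous_onI[OF continuous_STFT_coherent, of t X, folded measurable_lborel2]] meas(1)
    by measurable
  \<comment> \<open>Passing from \<open>exp (- s\<^sup>2 / 4)\<close> to a wider or a narrower Gaussian absorbs the exponential growth of the weights.\<close>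
  have upper: "norm (?F \<omega>1 t X Y) \<le> (t * D1 * \<omega>1 X) * norm (gaussian_at (1 / 8) X Y)" if t: "0 \<le> t" for t X Y
  proof -
    let ?s = "norm (Y - X)"
    have "r1 * ?s - ?s\<^sup>2 / 4 \<le> 2 * r1\<^sup>2 - ?s\<^sup>2 / 8"
      using zero_le_power2[of "?s - 4 * r1"] by (simp add: power2_diff power_mult_distrib mult.commute[of r1])
    then have "exp (r1 * ?s) * exp (- (?s\<^sup>2 / 4)) \<le> exp (2 * r1\<^sup>2) * exp (- (1 / 8 * ?s\<^sup>2))"
      by (simp flip: exp_add)
    from mult_left_mono[OF this, of "t * C1 * \<omega>1 X"]
    have "t * C1 * \<omega>1 X * (exp (r1 * ?s) * exp (- (?s\<^sup>2 / 4))) \<le> t * D1 * \<omega>1 X * exp (- (1 / 8 * ?s\<^sup>2))"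
      using t C1 pos(1)[of X] by (simp add: D1_def mult_ac)
    moreover have "t * exp (- (?s\<^sup>2 / 4)) * \<omega>1 Y \<le> t * exp (- (?s\<^sup>2 / 4)) * (C1 * exp (r1 * ?s) * \<omega>1 X)"
      using C1(3)[of X "Y - X"] t by (intro mult_left_mono) auto
    ultimately show ?thesis
      using pos(1)[of Y] by (simp add: norm_mult norm_STFT_coherent[OF t] gauss_norm mult_ac)
  qed
  have lower: "norm (gaussian_at (1 / 2) X Y) \<le> (D2 / (t * \<omega>2 X)) * norm (?F \<omega>2 t X Y)" if t: "0 < t" for t X Y
  proof -
    let ?s = "norm (Y - X)"
    have "- (1 / 2 * ?s\<^sup>2) + r2 * ?s \<le> r2\<^sup>2 - ?s\<^sup>2 / 4"
      using zero_le_power2[of "?s / 2 - r2"] by (simp add: power2_diff power_divide mult.commute[of r2])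
    then have "exp (- (1 / 2 * ?s\<^sup>2)) * exp (r2 * ?s) \<le> exp (r2\<^sup>2) * exp (- (?s\<^sup>2 / 4))"
      by (simp flip: exp_add)
    from mult_left_mono[OF this, of "C2 * \<omega>2 Y"]
    have "exp (- (1 / 2 * ?s\<^sup>2)) * (C2 * exp (r2 * ?s) * \<omega>2 Y) \<le> D2 * exp (- (?s\<^sup>2 / 4)) * \<omega>2 Y"
      using C2 pos(2)[of Y] by (simp add: D2_def mult_ac)
    moreover have "exp (- (1 / 2 * ?s\<^sup>2)) * \<omega>2 X \<le> exp (- (1 / 2 * ?s\<^sup>2)) * (C2 * exp (r2 * ?s) * \<omega>2 Y)"
      using C2(3)[of Y "X - Y"] by (intro mult_left_mono) (auto simp: norm_minus_commute)
    ultimately have "exp (- (1 / 2 * ?s\<^sup>2)) * \<omega>2 X \<le> D2 * exp (- (?s\<^sup>2 / 4)) * \<omega>2 Y"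
      by linarith
    then show ?thesis
      using t pos[of X] pos[of Y]
      by (simp add: norm_mult norm_STFT_coherent[OF less_imp_le[OF t]] gauss_norm field_simps)
  qed
  have F1: "coherent t X \<in> modulation_space \<omega>1 B" "modulation_norm \<omega>1 N (coherent t X) \<le> K * (t * D1 * \<omega>1 X) * M"
    if t: "0 \<le> t" for t X
  proof -
    have "?F \<omega>1 t X \<in> B \<and> N (?F \<omega>1 t X) \<le> K * (t * D1 * \<omega>1 X) * N (gaussian_at (1 / 8) X)"
      using upper[OF t] t D(1) less_imp_le[OF pos(1)] by (intro solidK[OF M(1) F_meas]) auto
    moreover have "K * (t * D1 * \<omega>1 X) * N (gaussian_at (1 / 8) X) \<le> K * (t * D1 * \<omega>1 X) * M"
      using t D(1) K less_imp_le[OF pos(1)] by (intro mult_left_mono M(2)) auto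
    ultimately show "coherent t X \<in> modulation_space \<omega>1 B"
        "modulation_norm \<omega>1 N (coherent t X) \<le> K * (t * D1 * \<omega>1 X) * M"
      by (auto simp: modulation_space_def modulation_norm_def coherent_in_H_flat')
  qed
  \<comment> \<open>Continuity is used at the zero expansion, written as a coherent state of size \<open>0\<close>.\<close>
  have zero: "g - coherent 0 undefined = g" for g :: "'d hermite_expansion"
    by (simp add: fun_eq_iff coherent_def)
  obtain \<delta> where \<delta>: "0 < \<delta>" "\<And>g. g \<in> modulation_space \<omega>1 B \<Longrightarrow> modulation_norm \<omega>1 N g < \<delta> \<Longrightarrow> modulation_norm \<omega>2 N g < 1"
    using cont[unfolded modulation_embedding_continuous_def quasinorm_continuous_def, THEN conjunct2, rule_format,
        OF F1(1)[of 0 undefined] zero_less_one] unfolding zero by auto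
  have sub: "modulation_space \<omega>1 B \<subseteq> modulation_space \<omega>2 B"
    using cont by (simp add: modulation_embedding_continuous_def quasinorm_continuous_def)
  define E where "E = K * D1 * (\<bar>M\<bar> + 1)"
  have E: "0 < E"
    using K D by (simp add: E_def add_nonneg_pos)
  have "\<omega>2 X / \<omega>1 X \<le> 2 * E * K * D2 / (\<delta> * m)" for X
  proof -
    \<comment> \<open>The size \<open>t\<close> makes the norm of the coherent state in the source space at most \<open>\<delta> / 2\<close>.\<close>
    define t where "t = \<delta> / (2 * E * \<omega>1 X)"
    have t: "0 < t"
      using \<delta>(1) E pos(1) by (simp add: t_def)
    have "modulation_norm \<omega>1 N (coherent t X) \<le> K * (t * D1 * \<omega>1 X) * (\<bar>M\<bar> + 1)"
      using t D(1) K less_imp_le[OF pos(1)] by (intro order_trans[OF F1(2)] mult_left_mono) auto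
    also have "\<dots> = E * (t * \<omega>1 X)"
      by (simp add: E_def)
    also have "\<dots> = \<delta> / 2"
      using E pos(1)[of X] by (simp add: t_def)
    also have "\<dots> < \<delta>"
      using \<delta>(1) by simp
    finally have less1: "modulation_norm \<omega>2 N (coherent t X) < 1"
      using \<delta>(2) F1(1) t by simp
    have mem: "?F \<omega>2 t X \<in> B"
      using F1(1)[of t X] sub t by (auto simp: modulation_space_def)
    have "m \<le> N (gaussian_at (1 / 2) X)"
      by (rule m(2))
    also have "\<dots> \<le> K * (D2 / (t * \<omega>2 X)) * N (?F \<omega>2 t X)"
      using lower[OF t] t D(2) less_imp_le[OF pos(2)]
      by (intro solidK[OF mem, THEN conjunct2] measurable_completion)
        (auto intro!: borel_measurable_continuous_onI continuous_gaussian_at)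
    also have "\<dots> \<le> K * (D2 / (t * \<omega>2 X)) * 1"
      using less1 K D(2) t pos(2)[of X] by (intro mult_left_mono) (auto simp: modulation_norm_def)
    finally have "m * \<omega>2 X \<le> K * D2 / t"
      using pos(2)[of X] t by (simp add: field_simps)
    also have "\<dots> = 2 * E * K * D2 / \<delta> * \<omega>1 X"
      using \<delta>(1) E by (simp add: t_def)
    finally show ?thesis
      using \<delta>(1) m(1) pos(1)[of X] by (simp add: field_simps)
  qed
  moreover have "0 < 2 * E * K * D2 / (\<delta> * m)"
    using E K D \<delta>(1) m(1) by simp
  ultimately show ?thesis
    by blast
qed

theorem theorem3p7:
  fixes \<omega>1 \<omega>2 v :: "(real ^ 'd::finite) \<times> (real ^ 'd) \<Rightarrow> real"
    and B :: "((real ^ 'd) \<times> (real ^ 'd) \<Rightarrow> complex) set"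
    and N :: "((real ^ 'd) \<times> (real ^ 'd) \<Rightarrow> complex) \<Rightarrow> real"
  assumes "weight \<omega>1" and "weight \<omega>2"
    and "moderate_weight v" and "submultiplicative v"
    and "invariant_BF_space B N v \<or> mixed_Lebesgue_space B N"
  shows "(bounded (range (\<lambda>X. \<omega>2 X / \<omega>1 X)) \<longrightarrow> modulation_embedding_continuous \<omega>1 \<omega>2 B N) \<and>
    (moderate_weight \<omega>1 \<and> moderate_weight \<omega>2 \<and> bounded (range v) \<longrightarrow>
      (modulation_embedding_continuous \<omega>1 \<omega>2 B N \<longleftrightarrow> (\<exists>C>0. \<forall>X. \<omega>2 X / \<omega>1 X \<le> C)))"
proof (intro conjI impI iffI)
  have solid: "solid_function_space B N"
    using assms(5) invariant_BF_space_imp_solid mixed_Lebesgue_space_imp_solid by blast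
  show "modulation_embedding_continuous \<omega>1 \<omega>2 B N" if bdd: "bounded (range (\<lambda>X. \<omega>2 X / \<omega>1 X))"
  proof -
    obtain C where C: "\<forall>q\<in>range (\<lambda>X. \<omega>2 X / \<omega>1 X). norm q \<le> C"
      using bdd unfolding bounded_iff by blast
    have "\<omega>2 X / \<omega>1 X \<le> C" for X
      using bspec[OF C rangeI, of X] abs_ge_self[of "\<omega>2 X / \<omega>1 X"] unfolding real_norm_def by (rule order_trans[rotated])
    then show ?thesis
      by (rule modulation_embedding_continuousI[OF solid assms(1,2)])
  qed
  show "modulation_embedding_continuous \<omega>1 \<omega>2 B N" if "\<exists>C>0. \<forall>X. \<omega>2 X / \<omega>1 X \<le> C"
    using that modulation_embedding_continuousI[OF solid assms(1,2)] by blast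
  show "\<exists>C>0. \<forall>X. \<omega>2 X / \<omega>1 X \<le> C"
    if "moderate_weight \<omega>1 \<and> moderate_weight \<omega>2 \<and> bounded (range v)" "modulation_embedding_continuous \<omega>1 \<omega>2 B N"
  proof -
    have "gaussians_uniform B N"
      using assms(5) that(1) invariant_BF_space_gaussians_uniform mixed_Lebesgue_space_gaussians_uniform by blast
    with solid that show ?thesis
      by (blast intro: weight_ratio_bounded)
  qed
qed

end
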